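(* Let $T$ be a tree with a leaf vertex $v_1$ and $N_T(v_1)=\{v\}$ satisfying the following conditions: (1) $v$ has $n>0$ leaf neighbors $v_1,\dots,v_n$, and at most one non-leaf neighbor, say $u$; (2) $u$ (if it exists) has at least one leaf neighbor. Then, for $T'=T\setminus\{v,v_1,\dots,v_n\}$, we have for all $r,d$ $$\beta_{r,d}\left(\frac{R}{NI(T)}\right)=\beta_{r,d}\left(\frac{R}{NI(T')}\right)+\sum_{i=1}^{n}\binom{n}{i}\,\beta_{r-i,d-i-1}\left(\frac{R}{NI(T')}\right).$$
   Context: All graphs are finite and simple; a tree is a connected graph with no cycles, and a leaf is a vertex of degree $1$. $N_G(x)$ is the set of neighbors of $x$ and $N_G[x]=N_G(x)\cup\{x\}$. $T\setminus S$ is the graph obtained by deleting the vertices in $S$ and all edges meeting $S$. $R$ is the polynomial ring over a field $\mathbb{K}$ whose variables are the vertices of $T$; for a graph $G$ with $V(G)\subseteq V(T)$, $NI(G)=\langle\prod_{y\in N_G[w]}y: w\in V(G)\rangle\subseteq R$ is the closed neighborhood ideal (the zero ideal if $V(G)=\emptyset$). $\beta_{r,d}(R/I)$ is the graded Betti number of $R/I$ in homological degree $r$ and internal degree $d$ (the number of copies of $R(-d)$ in the $r$-th module of the minimal graded free resolution of $R/I$), and is $0$ if $r<0$ or $d<0$. *)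

theory Defs
  imports "HOL-Library.Poly_Mapping" "Graph_Theory.Graph_Theory"
begin

section \<open>Trees\<close>

text \<open>
  A finite simple graph is a \<^locale>\<open>pair_graph\<close>: each edge $\{x,y\}$ is stored as the two arcs
  $(x,y)$ and $(y,x)$.  Since $x, y, x$ then is a closed walk that the library counts as a cycle, its
  \<^const>\<open>tree\<close> excludes every edge; the cycles of a simple graph are those of length at least 3.
\<close>

definition graph_tree :: "'a pair_pre_digraph \<Rightarrow> bool" where
  "graph_tree G \<longleftrightarrow> pair_graph G \<and> Digraph_Component.connected (with_proj G) \<and>
     \<not> (\<exists>p. pre_digraph.cycle (with_proj G) p \<and> length p \<ge> 3)"

definition nbrs :: "'a pair_pre_digraph \<Rightarrow> 'a \<Rightarrow> 'a set" where
  "nbrs G x = {y. (x, y) \<in> parcs G}"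

definition closed_nbrs :: "'a pair_pre_digraph \<Rightarrow> 'a \<Rightarrow> 'a set" where
  "closed_nbrs G x = insert x (nbrs G x)"

definition leaf :: "'a pair_pre_digraph \<Rightarrow> 'a \<Rightarrow> bool" where
  "leaf G x \<longleftrightarrow> x \<in> pverts G \<and> card (nbrs G x) = 1"

definition delete_verts :: "'a pair_pre_digraph \<Rightarrow> 'a set \<Rightarrow> 'a pair_pre_digraph" where
  "delete_verts G S =
     \<lparr> pverts = pverts G - S, parcs = {(x, y) \<in> parcs G. x \<notin> S \<and> y \<notin> S} \<rparr>"

section \<open>The polynomial ring and closed neighborhood ideals\<close>

text \<open>
  The type below is the polynomial ring over \<open>'k\<close> whose variables are all elements of \<open>'a\<close>
  (a polynomial maps exponent vectors to coefficients).
\<close>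

type_synonym ('a, 'k) mpoly = "('a \<Rightarrow>\<^sub>0 nat) \<Rightarrow>\<^sub>0 'k"

definition Var :: "'a \<Rightarrow> ('a, 'k::comm_ring_1) mpoly" where
  "Var x = Poly_Mapping.single (Poly_Mapping.single x 1) 1"

definition monom_degree :: "('a \<Rightarrow>\<^sub>0 nat) \<Rightarrow> nat" where
  "monom_degree m = (\<Sum>x\<in>Poly_Mapping.keys m. Poly_Mapping.lookup m x)"

definition ideal_gen :: "('a, 'k::comm_ring_1) mpoly set \<Rightarrow> ('a, 'k) mpoly set" where
  "ideal_gen = module.span (*)"

definition irrelevant_ideal :: "('a, 'k::comm_ring_1) mpoly set" where
  "irrelevant_ideal = ideal_gen (range Var)"

definition NI :: "'a pair_pre_digraph \<Rightarrow> ('a, 'k::comm_ring_1) mpoly set" where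
  "NI G = ideal_gen {\<Prod>y\<in>closed_nbrs G w. Var y | w. w \<in> pverts G}"

section \<open>Graded free modules\<close>

text \<open>
  The graded free module $\bigoplus_d R(-d)^{b_d}$ has the homogeneous basis elements
  $e_{(d,k)}$, $k < b_d$, of degree $d$.  Its elements are finitely supported families of
  coefficients indexed by the pairs $(d,k)$.
\<close>

type_synonym ('a, 'k) fvec = "(nat \<times> nat) \<Rightarrow>\<^sub>0 ('a, 'k) mpoly"

definition smult :: "('a, 'k::comm_ring_1) mpoly \<Rightarrow> ('a, 'k) fvec \<Rightarrow> ('a, 'k) fvec" where
  "smult p x = Poly_Mapping.map ((*) p) x"

definition free_module :: "(nat \<Rightarrow> nat) \<Rightarrow> ('a, 'k::zero) fvec set" where
  "free_module b = {x. \<forall>(d, k)\<in>Poly_Mapping.keys x. k < b d}"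

definition homogeneous :: "nat \<Rightarrow> ('a, 'k::zero) mpoly \<Rightarrow> bool" where
  "homogeneous e p \<longleftrightarrow> (\<forall>m\<in>Poly_Mapping.keys p. monom_degree m = e)"

definition fhomogeneous :: "nat \<Rightarrow> ('a, 'k::zero) fvec \<Rightarrow> bool" where
  "fhomogeneous e x \<longleftrightarrow> (\<forall>(d, k)\<in>Poly_Mapping.keys x.
     \<forall>m\<in>Poly_Mapping.keys (Poly_Mapping.lookup x (d, k)). monom_degree m + d = e)"

lemma module_mult: "module ((*) :: ('a, 'k::comm_ring_1) mpoly \<Rightarrow> _)"
  by unfold_locales (simp_all add: algebra_simps)

lemma lookup_smult: "Poly_Mapping.lookup (smult p x) i = p * Poly_Mapping.lookup x i"
  by (simp add: smult_def Poly_Mapping.map.rep_eq when_def)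

lemma module_smult: "module (smult :: ('a, 'k::comm_ring_1) mpoly \<Rightarrow> _)"
  by unfold_locales
    (simp_all add: poly_mapping_eq_iff fun_eq_iff lookup_smult lookup_add algebra_simps)

section \<open>Minimal graded free resolutions and graded Betti numbers\<close>

text \<open>
  A graded free resolution
  $\cdots \to F_2 \to F_1 \to F_0 \to R/I \to 0$ of $R/I$ has
  $F_r = \bigoplus_d R(-d)^{b_{r,d}}$, with \<open>\<phi> r\<close> the differential $F_{r+1} \to F_r$ (a module
  homomorphism on all families, of which only the restriction to $F_{r+1}$ matters).
  The augmentation $F_0 \to R/I$ is given by a graded lift \<open>\<epsilon>\<close> to $R$, so that
  it is onto if every polynomial is congruent modulo $I$ to a value of \<open>\<epsilon>\<close>, and its kernel is the
  preimage of $I$ under \<open>\<epsilon>\<close>.  Each $b_{r,d}$ is finite, and it is not required in addition that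
  $F_r$ have finite rank: for the minimal resolution this is automatic.
\<close>

definition graded_free_resolution ::
  "('a, 'k::comm_ring_1) mpoly set \<Rightarrow> (nat \<Rightarrow> nat \<Rightarrow> nat) \<Rightarrow>
   (nat \<Rightarrow> ('a, 'k) fvec \<Rightarrow> ('a, 'k) fvec) \<Rightarrow> (('a, 'k) fvec \<Rightarrow> ('a, 'k) mpoly) \<Rightarrow> bool" where
  "graded_free_resolution I b \<phi> \<epsilon> \<longleftrightarrow>
     module_hom smult (*) \<epsilon> \<and>
     (\<forall>e. \<forall>x\<in>free_module (b 0). fhomogeneous e x \<longrightarrow> homogeneous e (\<epsilon> x)) \<and>
     (\<forall>r. module_hom smult smult (\<phi> r) \<and> \<phi> r ` free_module (b (Suc r)) \<subseteq> free_module (b r) \<and>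
       (\<forall>e. \<forall>x\<in>free_module (b (Suc r)). fhomogeneous e x \<longrightarrow> fhomogeneous e (\<phi> r x))) \<and>
     (\<forall>p. \<exists>x\<in>free_module (b 0). p - \<epsilon> x \<in> I) \<and>
     {x \<in> free_module (b 0). \<epsilon> x \<in> I} = \<phi> 0 ` free_module (b 1) \<and>
     (\<forall>r. {x \<in> free_module (b (Suc r)). \<phi> r x = 0} = \<phi> (Suc r) ` free_module (b (Suc (Suc r))))"

text \<open>Minimality: $\varphi_r(F_{r+1}) \subseteq \mathfrak{m} F_r$ for the irrelevant ideal
  $\mathfrak{m}$, where $\mathfrak{m} F_r$ consists of the elements of $F_r$ with all coefficients
  in $\mathfrak{m}$.\<close>

definition minimal_graded_free_resolution ::
  "('a, 'k::comm_ring_1) mpoly set \<Rightarrow> (nat \<Rightarrow> nat \<Rightarrow> nat) \<Rightarrow>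
   (nat \<Rightarrow> ('a, 'k) fvec \<Rightarrow> ('a, 'k) fvec) \<Rightarrow> (('a, 'k) fvec \<Rightarrow> ('a, 'k) mpoly) \<Rightarrow> bool" where
  "minimal_graded_free_resolution I b \<phi> \<epsilon> \<longleftrightarrow>
     graded_free_resolution I b \<phi> \<epsilon> \<and>
     (\<forall>r. \<forall>x\<in>free_module (b (Suc r)). \<forall>i. Poly_Mapping.lookup (\<phi> r x) i \<in> irrelevant_ideal)"

text \<open>\<open>betti I r d\<close> is $\beta_{r,d}(R/I)$, for a homogeneous ideal $I$ over a field.\<close>

definition betti :: "('a::finite, 'k::field) mpoly set \<Rightarrow> int \<Rightarrow> int \<Rightarrow> nat" where
  "betti I r d = (if r < 0 \<or> d < 0 then 0 else
     (THE n. \<exists>b \<phi> \<epsilon>. minimal_graded_free_resolution I b \<phi> \<epsilon> \<and> n = b (nat r) (nat d)))"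

end

theory Submission
  imports Defs
begin

text \<open>
  Write $L = \{v_1,\dots,v_n\}$ and $I = NI(T')$.  The generators of $NI(T)$ at $v_1,\dots,v_n$ are
  the monomials $v v_i$.  The generator at \<open>v\<close> is a multiple of each of them, and the generator at
  a non-leaf neighbor \<open>u\<close> of \<open>v\<close> is a multiple of the generator $u w$ at a leaf \<open>w\<close> of \<open>u\<close>,
  both in \<open>T\<close> and in \<open>T'\<close>; the remaining generators of \<open>T\<close> and \<open>T'\<close> agree.  Hence
  $NI(T) = I + v(v_1,\dots,v_n)$, where \<open>I\<close> does not involve the variables $v, v_1,\dots,v_n$.

  The Betti numbers are then found by adjoining one generator at a time.  Let
  $J_k = I + (v_1,\dots,v_k)$ and $I_k = I + v(v_1,\dots,v_k)$.  Then $J_{k-1} : v_k = J_{k-1}$ and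
  $I_{k-1} : v v_k = J_{k-1}$.  In general, if $I' = I : xf$ for a variable \<open>x\<close> and a homogeneous
  \<open>f\<close> of degree \<open>s\<close> with $f I' \subseteq I$, multiplication by \<open>f\<close> lifts to a map \<open>\<psi>\<close> between the
  minimal resolutions of $R/I'$ and $R/I$; the mapping cone of $x\psi$ resolves $R/(I + (xf))$ and
  is again minimal because of the factor \<open>x\<close>.  So (\<open>mapping_cone\<close>, \<open>betti_mon_ideal_insert\<close>)
  $$\beta_{r,d}(R/(I+(xf))) = \beta_{r,d}(R/I) + \beta_{r-1,d-1-s}(R/I').$$
  With $f = 1$ this gives
  $\beta_{r,d}(R/J_k) = \sum_i \binom{k}{i} \beta_{r-i,d-i}(R/I)$ (\<open>betti_adjoin_variables\<close>), and with
  $f = v$ the asserted formula for $R/I_k$ (\<open>betti_adjoin_star\<close>), both by Pascal's rule.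

  All of this needs minimal graded free resolutions to exist (\<open>minimal_resolution_exists\<close>: generators
  are chosen degree by degree, as bases of complements of the part that comes from lower degrees, and
  each graded piece is finite-dimensional) and their ranks to be unique (\<open>betti_le\<close>: the composition of
  two comparison maps is homotopic to the identity, and therefore is the identity modulo
  $\mathfrak{m}$).
\<close>

abbreviation "lookup \<equiv> Poly_Mapping.lookup"
abbreviation "keys \<equiv> Poly_Mapping.keys"
abbreviation "single \<equiv> Poly_Mapping.single"

interpretation fv: module "smult :: ('a, 'k::comm_ring_1) mpoly \<Rightarrow> _"
  by (rule module_smult)

interpretation pr: module "(*) :: ('a, 'k::comm_ring_1) mpoly \<Rightarrow> _"
  by (rule module_mult)

text \<open>Basis indices are pairs, but they are treated as atomic almost everywhere.\<close>

declare split_paired_All [simp del] split_paired_Ex [simp del]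

section \<open>Free modules and linear maps\<close>

lemma fvec_eqI: "(\<And>i. lookup x i = lookup y i) \<Longrightarrow> x = (y :: ('a, 'k::zero) fvec)"
  by (rule poly_mapping_eqI)

text \<open>The index set of the basis of the free module with \<open>b d\<close> generators in degree \<open>d\<close>, and the basis
  elements themselves.\<close>

definition basis :: "(nat \<Rightarrow> nat) \<Rightarrow> (nat \<times> nat) set" where
  "basis b = {(d, k). k < b d}"

abbreviation unit :: "nat \<times> nat \<Rightarrow> ('a, 'k::comm_ring_1) fvec" where
  "unit i \<equiv> single i 1"

lemma free_module_iff: "x \<in> free_module b \<longleftrightarrow> keys x \<subseteq> basis b"
  by (auto simp: free_module_def basis_def)

lemma free_module_iff_lookup: "x \<in> free_module b \<longleftrightarrow> (\<forall>i. i \<notin> basis b \<longrightarrow> lookup x i = 0)"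
  by (auto simp: free_module_iff in_keys_iff)

lemma subspace_free_module: "fv.subspace (free_module b)"
  by (auto simp: fv.subspace_def free_module_iff_lookup lookup_add lookup_smult)

lemma unit_in_free_module: "i \<in> basis b \<Longrightarrow> unit i \<in> free_module b"
  by (auto simp: free_module_iff_lookup lookup_single when_def)

text \<open>The linear map that sends the basis element with index \<open>i\<close> to \<open>g i\<close>.  It is defined on all
  families, as the differentials of a resolution are.\<close>

definition lin :: "(nat \<times> nat \<Rightarrow> ('a, 'k) fvec) \<Rightarrow> ('a, 'k::comm_ring_1) fvec \<Rightarrow> ('a, 'k) fvec" where
  "lin g x = (\<Sum>i\<in>keys x. smult (lookup x i) (g i))"

lemma lin_superset:
  assumes "finite A" "keys x \<subseteq> A"
  shows "lin g x = (\<Sum>i\<in>A. smult (lookup x i) (g i))"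
  unfolding lin_def
  by (rule sum.mono_neutral_left) (use assms in \<open>auto simp: in_keys_iff\<close>)

lemma hom_lin: "module_hom smult smult (lin g)"
proof
  fix x y :: "('a, 'b) fvec"
  have "keys (x + y) \<subseteq> keys x \<union> keys y" by (rule keys_add)
  then show "lin g (x + y) = lin g x + lin g y"
    by (simp add: lin_superset[of "keys x \<union> keys y"] lookup_add fv.scale_left_distrib sum.distrib)
next
  fix p and x :: "('a, 'b) fvec"
  have "keys (smult p x) \<subseteq> keys x" by (auto simp: in_keys_iff lookup_smult)
  then show "lin g (smult p x) = smult p (lin g x)"
    by (simp add: lin_superset[of "keys x"] lookup_smult fv.scale_sum_right)
qed

lemma lin_unit [simp]: "lin g (unit i) = g i"
  by (simp add: lin_def)

lemma lookup_lin_unit: "lookup (lin (\<lambda>i. unit i) x) j = lookup x j"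
proof -
  have "lookup (lin (\<lambda>i. unit i) x) j = (\<Sum>i\<in>keys x. if i = j then lookup x i else 0)"
    by (simp add: lin_def lookup_sum lookup_smult lookup_single when_def if_distrib cong: if_cong)
  also have "\<dots> = lookup x j" by (simp add: in_keys_iff)
  finally show ?thesis .
qed

lemma fvec_expand: "(\<Sum>i\<in>keys x. smult (lookup x i) (unit i)) = x"
  by (rule fvec_eqI) (simp add: lookup_lin_unit flip: lin_def)

lemma hom_expand:
  assumes "module_hom smult s h"
  shows "h x = (\<Sum>i\<in>keys x. s (lookup x i) (h (unit i)))"
proof -
  interpret h: module_hom smult s h by fact
  show ?thesis by (subst fvec_expand[of x, symmetric]) (simp only: h.sum h.scale)
qed

lemma free_module_induct:
  assumes "fv.subspace M" "\<And>i. i \<in> basis b \<Longrightarrow> unit i \<in> M" "x \<in> free_module b"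
  shows "x \<in> M"
proof -
  have "(\<Sum>i\<in>keys x. smult (lookup x i) (unit i)) \<in> M"
    using assms by (intro fv.subspace_sum fv.subspace_scale) (auto simp: free_module_iff)
  then show ?thesis by (simp add: fvec_expand)
qed

lemma subspace_eq_hom:
  assumes "module_hom smult s f" "module_hom smult s g"
  shows "fv.subspace {x. f x = g x}"
proof -
  interpret f: module_hom smult s f by fact
  interpret g: module_hom smult s g by fact
  show ?thesis by (auto simp: fv.subspace_def f.add f.scale g.add g.scale)
qed

lemma hom_eq_on_free_module:
  assumes "module_hom smult s f" "module_hom smult s g" "\<And>i. i \<in> basis b \<Longrightarrow> f (unit i) = g (unit i)"
    "x \<in> free_module b"
  shows "f x = g x"
  using free_module_induct[OF subspace_eq_hom[OF assms(1,2)], of b x] assms(3,4) by auto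

lemma hom_maps_free_module:
  assumes "module_hom smult smult f" "\<And>i. i \<in> basis b \<Longrightarrow> f (unit i) \<in> M" "fv.subspace M"
  shows "f ` free_module b \<subseteq> M"
proof -
  interpret f: module_hom smult smult f by fact
  have "fv.subspace {x. f x \<in> M}"
    using assms(3) by (rule f.subspace_linear_preimage)
  from free_module_induct[OF this] assms(2) show ?thesis by auto
qed

section \<open>Gradings\<close>

lemma monom_degree_eq: "monom_degree (m :: 'a::finite \<Rightarrow>\<^sub>0 nat) = (\<Sum>x\<in>UNIV. lookup m x)"
  unfolding monom_degree_def by (rule sum.mono_neutral_left) (auto simp: in_keys_iff)

lemma monom_degree_add: "monom_degree (m + m' :: 'a::finite \<Rightarrow>\<^sub>0 nat) = monom_degree m + monom_degree m'"
  by (simp add: monom_degree_eq lookup_add sum.distrib)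

lemma monom_degree_zero [simp]: "monom_degree 0 = 0"
  by (simp add: monom_degree_def)

lemma monom_degree_single [simp]: "monom_degree (single x n) = n"
  by (cases "n = 0") (simp_all add: monom_degree_def)

lemma monom_degree_eq_0_iff: "monom_degree m = 0 \<longleftrightarrow> m = 0"
proof
  assume "monom_degree m = 0"
  then show "m = 0" by (intro poly_mapping_eqI) (auto simp: monom_degree_def in_keys_iff)
qed simp

lemma homogeneous_iff: "homogeneous e p \<longleftrightarrow> (\<forall>m. lookup p m \<noteq> 0 \<longrightarrow> monom_degree m = e)"
  by (auto simp: homogeneous_def in_keys_iff)

lemma fhomogeneous_iff:
  "fhomogeneous e x \<longleftrightarrow> (\<forall>i m. lookup (lookup x i) m \<noteq> 0 \<longrightarrow> monom_degree m + fst i = e)"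
  by (force simp: fhomogeneous_def in_keys_iff)

lemma fhomogeneous_0 [simp]: "fhomogeneous e 0"
  by (simp add: fhomogeneous_iff)

lemma fhomogeneous_add: "fhomogeneous e x \<Longrightarrow> fhomogeneous e y \<Longrightarrow> fhomogeneous e (x + y)"
  unfolding fhomogeneous_iff lookup_add by (metis add.right_neutral)

lemma fhomogeneous_neg: "fhomogeneous e x \<Longrightarrow> fhomogeneous e (- x :: ('a, 'k::comm_ring_1) fvec)"
  by (auto simp: fhomogeneous_iff)

lemma fhomogeneous_diff:
  "fhomogeneous e x \<Longrightarrow> fhomogeneous e y \<Longrightarrow> fhomogeneous e (x - y :: ('a, 'k::comm_ring_1) fvec)"
  using fhomogeneous_add[OF _ fhomogeneous_neg, of e x y] by simp

lemma fhomogeneous_sum: "(\<And>i. i \<in> A \<Longrightarrow> fhomogeneous e (f i)) \<Longrightarrow> fhomogeneous e (\<Sum>i\<in>A. f i)"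
  by (induction A rule: infinite_finite_induct) (auto intro: fhomogeneous_add)

lemma homogeneous_mult:
  assumes "homogeneous d p" "homogeneous e q"
  shows "homogeneous (d + e) (p * q :: ('a::finite, 'k::comm_ring_1) mpoly)"
  unfolding homogeneous_def
proof
  fix m assume "m \<in> keys (p * q)"
  then obtain m1 m2 where "m = m1 + m2" "m1 \<in> keys p" "m2 \<in> keys q" using keys_mult[of p q] by blast
  then show "monom_degree m = d + e" using assms by (auto simp: homogeneous_def monom_degree_add)
qed

lemma fhomogeneous_iff_homogeneous:
  "fhomogeneous e x \<longleftrightarrow> (\<forall>i. lookup x i \<noteq> 0 \<longrightarrow> fst i \<le> e \<and> homogeneous (e - fst i) (lookup x i))"
proof
  assume L: "fhomogeneous e x"
  show "\<forall>i. lookup x i \<noteq> 0 \<longrightarrow> fst i \<le> e \<and> homogeneous (e - fst i) (lookup x i)"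
  proof (intro allI impI)
    fix i assume "lookup x i \<noteq> 0"
    then obtain m where "lookup (lookup x i) m \<noteq> 0" by (metis poly_mapping_eqI lookup_zero)
    then have "monom_degree m + fst i = e" using L by (auto simp: fhomogeneous_iff)
    then have "fst i \<le> e" by simp
    then show "fst i \<le> e \<and> homogeneous (e - fst i) (lookup x i)"
      using L by (force simp: fhomogeneous_iff homogeneous_iff)
  qed
next
  assume R: "\<forall>i. lookup x i \<noteq> 0 \<longrightarrow> fst i \<le> e \<and> homogeneous (e - fst i) (lookup x i)"
  show "fhomogeneous e x"
    unfolding fhomogeneous_iff
  proof (intro allI impI)
    fix i m assume *: "lookup (lookup x i) m \<noteq> 0"
    then have "lookup x i \<noteq> 0" by auto
    with R * show "monom_degree m + fst i = e" by (auto simp: homogeneous_iff)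
  qed
qed

lemma fhomogeneous_smult:
  assumes "homogeneous d p" "fhomogeneous e x"
  shows "fhomogeneous (d + e) (smult p x :: ('a::finite, 'k::comm_ring_1) fvec)"
  unfolding fhomogeneous_iff_homogeneous
proof (intro allI impI)
  fix i assume "lookup (smult p x) i \<noteq> 0"
  then have "lookup x i \<noteq> 0" by (auto simp: lookup_smult)
  then have "fst i \<le> e" "homogeneous (e - fst i) (lookup x i)"
    using assms by (auto simp: fhomogeneous_iff_homogeneous)
  then show "fst i \<le> d + e \<and> homogeneous (d + e - fst i) (lookup (smult p x) i)"
    using homogeneous_mult[OF assms(1), of "e - fst i" "lookup x i"] by (auto simp: lookup_smult)
qed

lemma homogeneous_single: "homogeneous (monom_degree m) (single m c)"
  by (auto simp: homogeneous_iff lookup_single when_def)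

lemma homogeneous_Var: "homogeneous 1 (Var a)"
  by (metis Var_def homogeneous_single monom_degree_single)

lemma fhomogeneous_unit: "fhomogeneous (fst i) (unit i)"
  by (auto simp: fhomogeneous_iff lookup_single lookup_one when_def split: if_splits)

text \<open>The homogeneous component of degree \<open>e\<close> of an element of a graded free module.\<close>

definition fcomp :: "nat \<Rightarrow> ('a, 'k::comm_ring_1) fvec \<Rightarrow> ('a, 'k) fvec" where
  "fcomp e x = Poly_Mapping.mapp
     (\<lambda>i p. Poly_Mapping.mapp (\<lambda>m c. c when monom_degree m + fst i = e) p) x"

lemma lookup_fcomp: "lookup (lookup (fcomp e x) i) m = (lookup (lookup x i) m when monom_degree m + fst i = e)"
  by (auto simp: fcomp_def lookup_mapp when_def in_keys_iff)

lemma fvec_eqI2: "(\<And>i m. lookup (lookup x i) m = lookup (lookup y i) m) \<Longrightarrow> x = (y :: ('a, 'k::zero) fvec)"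
  by (intro poly_mapping_eqI)

lemma fcomp_add: "fcomp e (x + y) = fcomp e x + fcomp e y"
  by (rule fvec_eqI2) (simp add: lookup_fcomp lookup_add when_add_distrib)

lemma fcomp_0 [simp]: "fcomp e 0 = 0"
  by (rule fvec_eqI2) (simp add: lookup_fcomp)

lemma fcomp_sum: "fcomp e (\<Sum>i\<in>A. f i) = (\<Sum>i\<in>A. fcomp e (f i))"
  by (induction A rule: infinite_finite_induct) (auto simp: fcomp_add)

lemma fhomogeneous_fcomp: "fhomogeneous e (fcomp e x)"
  by (auto simp: fhomogeneous_iff lookup_fcomp)

lemma fcomp_fhomogeneous: "fhomogeneous e x \<Longrightarrow> fcomp e' x = (x when e = e')"
  by (rule fvec_eqI2) (auto simp: lookup_fcomp fhomogeneous_iff when_def)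

lemma fcomp_in_free_module: "x \<in> free_module b \<Longrightarrow> fcomp e x \<in> free_module b"
  by (auto simp: free_module_iff_lookup intro!: poly_mapping_eqI simp: lookup_fcomp)

text \<open>The degrees in which an element has a nonzero homogeneous component.\<close>

definition degrees :: "('a, 'k::comm_ring_1) fvec \<Rightarrow> nat set" where
  "degrees x = (\<lambda>(i, m). monom_degree m + fst i) ` (SIGMA i:keys x. keys (lookup x i))"

lemma finite_degrees: "finite (degrees x)"
  by (simp add: degrees_def)

lemma fcomp_not_in_degrees: "e \<notin> degrees x \<Longrightarrow> fcomp e x = 0"
  by (rule fvec_eqI2) (force simp: lookup_fcomp when_def degrees_def image_iff in_keys_iff)

lemma sum_fcomp: "(\<Sum>e\<in>degrees x. fcomp e x) = x"
proof (rule fvec_eqI2)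
  fix i m
  show "lookup (lookup (\<Sum>e\<in>degrees x. fcomp e x) i) m = lookup (lookup x i) m"
  proof (cases "lookup (lookup x i) m = 0")
    case False
    then have "monom_degree m + fst i \<in> degrees x"
      unfolding degrees_def image_iff
      by (intro bexI[of _ "(i, m)"]) (auto simp: in_keys_iff)
    then show ?thesis
      by (simp add: lookup_sum lookup_fcomp when_def finite_degrees sum.delta)
  qed (simp add: lookup_sum lookup_fcomp)
qed

text \<open>A map that is graded of degree \<open>s\<close> commutes with taking homogeneous components.\<close>

lemma fcomp_hom:
  assumes h: "module_hom smult smult h"
    and gr: "\<And>e x. x \<in> free_module b \<Longrightarrow> fhomogeneous e x \<Longrightarrow> fhomogeneous (e + s) (h x)"
    and x: "x \<in> free_module b"
  shows "fcomp (e + s) (h x) = h (fcomp e x)"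
proof -
  interpret h: module_hom smult smult h by fact
  have *: "fcomp (e + s) (h (fcomp e' x)) = (h (fcomp e' x) when e' = e)" for e'
    using fcomp_fhomogeneous[OF gr[OF fcomp_in_free_module[OF x] fhomogeneous_fcomp], where e' = "e + s"]
    by (simp add: when_def)
  have "fcomp (e + s) (h x) = fcomp (e + s) (\<Sum>e'\<in>degrees x. h (fcomp e' x))"
    by (simp add: sum_fcomp flip: h.sum)
  also have "\<dots> = (\<Sum>e'\<in>degrees x. h (fcomp e' x) when e' = e)"
    by (simp add: fcomp_sum *)
  also have "\<dots> = h (fcomp e x)"
    by (cases "e \<in> degrees x") (auto simp: when_def finite_degrees fcomp_not_in_degrees)
  finally show ?thesis .
qed

text \<open>A linear map that sends the basis to homogeneous elements is graded.\<close>

lemma graded_hom: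
  assumes h: "module_hom smult smult h"
    and gr: "\<And>i. i \<in> basis b \<Longrightarrow> fhomogeneous (fst i + s) (h (unit i))"
    and x: "x \<in> free_module b" "fhomogeneous e x"
  shows "fhomogeneous (e + s) (h x :: ('a::finite, 'k::comm_ring_1) fvec)"
proof -
  have "fhomogeneous (e + s) (smult (lookup x i) (h (unit i)))" if i: "i \<in> keys x" for i
  proof -
    have "fst i \<le> e" "homogeneous (e - fst i) (lookup x i)"
      using i x(2) by (auto simp: fhomogeneous_iff_homogeneous in_keys_iff)
    moreover have "i \<in> basis b" using i x(1) by (auto simp: free_module_iff)
    ultimately show ?thesis using fhomogeneous_smult[OF _ gr, of "e - fst i" "lookup x i" i] by auto
  qed
  then have "fhomogeneous (e + s) (\<Sum>i\<in>keys x. smult (lookup x i) (h (unit i)))"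
    by (rule fhomogeneous_sum)
  then show ?thesis by (subst hom_expand[OF h])
qed

section \<open>Elements with coefficients in the irrelevant ideal\<close>

text \<open>Elements of $\mathfrak{m}F$, that is, with all constant terms zero.\<close>

definition mvec :: "('a, 'k::comm_ring_1) fvec \<Rightarrow> bool" where
  "mvec x \<longleftrightarrow> (\<forall>i. lookup (lookup x i) 0 = 0)"

lemma lookup_mult_0: "lookup (p * q) 0 = lookup p 0 * lookup (q :: ('a, 'k::comm_ring_1) mpoly) 0"
proof -
  have dec: "p = single 0 (lookup p 0) + (p - single 0 (lookup p 0))" by simp
  have *: "lookup (r * q) 0 = 0" if "lookup r 0 = 0" for r :: "('a, 'k) mpoly"
  proof (rule ccontr)
    assume "lookup (r * q) 0 \<noteq> 0"
    then have "0 \<in> keys (r * q)" by (simp add: in_keys_iff)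
    then obtain a b where ab: "0 = a + b" "a \<in> keys r" using keys_mult[of r q] by blast
    have "a = 0" by (rule poly_mapping_eqI) (metis ab(1) add_eq_0_iff_both_eq_0 lookup_add lookup_zero)
    with ab that show False by (simp add: in_keys_iff)
  qed
  have s: "single 0 c * q = Poly_Mapping.map ((*) c) q" for c by (simp add: mult_map_scale_conv_mult)
  have "p * q = single 0 (lookup p 0) * q + (p - single 0 (lookup p 0)) * q" by (simp flip: distrib_right)
  then show ?thesis by (simp add: lookup_add * s lookup_minus Poly_Mapping.map.rep_eq when_def)
qed

lemma subspace_mvec: "fv.subspace {x. mvec x}"
  by (auto simp: fv.subspace_def mvec_def lookup_add lookup_smult lookup_mult_0)

lemma mvec_hom:
  assumes "module_hom smult smult h" "mvec x"
  shows "mvec (h x)"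
  by (subst hom_expand[OF assms(1)])
    (use assms(2) in \<open>auto simp: mvec_def lookup_sum lookup_smult lookup_mult_0\<close>)

lemma poly_mapping_expand: "(\<Sum>m\<in>keys p. single m (lookup p m)) = p"
  by (rule poly_mapping_eqI) (auto simp: lookup_sum lookup_single when_def in_keys_iff)

lemma monom_split_Var:
  assumes "m \<noteq> 0"
  obtains a m' where "m = single a 1 + (m' :: 'a \<Rightarrow>\<^sub>0 nat)"
proof -
  from assms obtain a where a: "lookup m a \<noteq> 0" by (metis poly_mapping_eqI lookup_zero)
  have "m = single a 1 + (m - single a 1)"
    using a by (intro poly_mapping_eqI) (auto simp: lookup_add lookup_minus lookup_single when_def)
  then show ?thesis by (rule that)
qed

lemma single_mult_Var: "single (single a 1 + m) c = Var a * single m c"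
  by (simp add: Var_def mult_single)

lemma single_1_neq_0: "single a (1::nat) \<noteq> 0"
  by (metis lookup_single_eq lookup_zero one_neq_zero)

lemma irrelevant_ideal_iff: "p \<in> irrelevant_ideal \<longleftrightarrow> lookup p 0 = 0"
proof
  assume "p \<in> irrelevant_ideal"
  then have p: "p \<in> pr.span (range Var)" by (simp add: irrelevant_ideal_def ideal_gen_def)
  have "pr.subspace {p :: ('a, 'b) mpoly. lookup p 0 = 0}"
    by (auto simp: pr.subspace_def lookup_add lookup_mult_0)
  moreover have "lookup (Var a :: ('a, 'b) mpoly) 0 = 0" for a
    by (simp add: Var_def lookup_single when_def single_1_neq_0[unfolded One_nat_def])
  ultimately show "lookup p 0 = 0"
    using pr.span_induct[OF p, of "\<lambda>p. lookup p 0 = 0"] by auto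
next
  assume 0: "lookup p 0 = 0"
  have "single m (lookup p m) \<in> pr.span (range Var)" if "m \<in> keys p" for m
  proof -
    have "m \<noteq> 0" using 0 that by (auto simp: in_keys_iff)
    then obtain a m' where m: "m = single a 1 + m'" by (rule monom_split_Var)
    show ?thesis unfolding m single_mult_Var
      by (subst mult.commute) (intro pr.span_scale pr.span_base rangeI)
  qed
  then have "(\<Sum>m\<in>keys p. single m (lookup p m)) \<in> pr.span (range Var)" by (rule pr.span_sum)
  then show "p \<in> irrelevant_ideal" by (simp add: poly_mapping_expand irrelevant_ideal_def ideal_gen_def)
qed

section \<open>Comparison of resolutions\<close>

text \<open>A linear map \<open>g\<close> on a free module lifts through \<open>\<phi>\<close> as soon as its values on the basis do, and
  the lifts of the basis elements can be chosen with a property \<open>Q\<close>, such as homogeneity.\<close>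

lemma lift_on_basis:
  assumes hom: "module_hom smult smult \<phi>" "module_hom smult smult g"
    and ex: "\<And>i. i \<in> basis b \<Longrightarrow> \<exists>y\<in>free_module c. \<phi> y = g (unit i) \<and> Q i y"
  shows "\<exists>\<psi>. module_hom smult smult \<psi> \<and> \<psi> ` free_module b \<subseteq> free_module c \<and>
    (\<forall>x\<in>free_module b. \<phi> (\<psi> x) = g x) \<and> (\<forall>i\<in>basis b. Q i (\<psi> (unit i)))"
proof -
  obtain y where y: "\<And>i. i \<in> basis b \<Longrightarrow> y i \<in> free_module c \<and> \<phi> (y i) = g (unit i) \<and> Q i (y i)"
    using ex by metis
  show ?thesis
  proof (intro exI[of _ "lin y"] conjI ballI)
    show "module_hom smult smult (lin y)" by (rule hom_lin)
    show "lin y ` free_module b \<subseteq> free_module c"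
      using y by (intro hom_maps_free_module hom_lin subspace_free_module) auto
    have "module_hom smult smult (\<phi> \<circ> lin y)" by (rule module_hom_compose[OF hom_lin hom(1)])
    then show "\<phi> (lin y x) = g x" if "x \<in> free_module b" for x
      using hom_eq_on_free_module[of smult "\<phi> \<circ> lin y" g b x] hom(2) y that by simp
    show "Q i (lin y (unit i))" if "i \<in> basis b" for i using y that by simp
  qed
qed

lemma homogeneous_preimage:
  assumes "module_hom smult smult \<phi>"
    and "\<And>e x. x \<in> free_module c \<Longrightarrow> fhomogeneous e x \<Longrightarrow> fhomogeneous e (\<phi> x)"
    and "z \<in> \<phi> ` free_module c" "fhomogeneous e z"
  shows "\<exists>y\<in>free_module c. \<phi> y = z \<and> fhomogeneous e y"
proof -
  obtain y where y: "y \<in> free_module c" "z = \<phi> y" using assms(3) by auto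
  have "fcomp (e + 0) (\<phi> y) = \<phi> (fcomp e y)" using assms(1,2) y by (intro fcomp_hom) auto
  moreover have "fcomp e (\<phi> y) = \<phi> y" using fcomp_fhomogeneous[OF assms(4), of e] y by simp
  ultimately show ?thesis
    using y by (intro bexI[of _ "fcomp e y"]) (auto simp: fcomp_in_free_module fhomogeneous_fcomp)
qed

text \<open>The ring itself is viewed as the free module with basis element \<open>(0, 0)\<close>, so that the
  lemmas on free modules apply to the augmentation map.\<close>

definition emb :: "('a, 'k::comm_ring_1) mpoly \<Rightarrow> ('a, 'k) fvec" where
  "emb p = single (0, 0) p"

text \<open>The homogeneous component of degree \<open>e\<close> of a polynomial.\<close>

definition hcomp :: "nat \<Rightarrow> ('a, 'k::comm_ring_1) mpoly \<Rightarrow> ('a, 'k) mpoly" where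
  "hcomp e p = lookup (fcomp e (emb p)) (0, 0)"

lemma lookup_hcomp: "lookup (hcomp e p) m = (lookup p m when monom_degree m = e)"
  by (simp add: hcomp_def lookup_fcomp emb_def)

lemma hcomp_diff: "hcomp e (p - q) = hcomp e p - hcomp e q"
  by (rule poly_mapping_eqI) (simp add: lookup_hcomp lookup_minus when_def)

lemma hcomp_homogeneous: "homogeneous e p \<Longrightarrow> hcomp e p = p"
  by (rule poly_mapping_eqI) (auto simp: lookup_hcomp homogeneous_iff when_def)

lemma fcomp_emb: "fcomp e (emb p) = emb (hcomp e p)"
  by (rule fvec_eqI2) (auto simp: lookup_fcomp emb_def lookup_single lookup_hcomp when_def)

lemma emb_inject: "emb p = emb q \<longleftrightarrow> p = q"
  by (metis emb_def lookup_single_eq)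

lemma hom_emb: "module_hom (*) smult emb"
  by unfold_locales
    (auto simp: emb_def single_add algebra_simps lookup_smult lookup_single when_def
      intro!: poly_mapping_eqI)

lemma fhomogeneous_emb: "fhomogeneous e (emb p) \<longleftrightarrow> homogeneous e p"
  by (auto simp: fhomogeneous_iff homogeneous_iff emb_def lookup_single when_def)

lemma hcomp_hom:
  assumes "module_hom smult (*) \<epsilon>"
    and "\<And>e x. x \<in> free_module b \<Longrightarrow> fhomogeneous e x \<Longrightarrow> homogeneous e (\<epsilon> x)"
    and "x \<in> free_module b"
  shows "hcomp e (\<epsilon> x) = \<epsilon> (fcomp e x)"
proof -
  have "fcomp (e + 0) ((emb \<circ> \<epsilon>) x) = (emb \<circ> \<epsilon>) (fcomp e x)"
    using assms by (intro fcomp_hom module_hom_compose[OF _ hom_emb]) (auto simp: fhomogeneous_emb)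
  then show ?thesis by (simp add: fcomp_emb emb_inject)
qed

text \<open>A homogeneous ideal: it contains the homogeneous components of its elements.\<close>

definition graded_ideal :: "('a, 'k::comm_ring_1) mpoly set \<Rightarrow> bool" where
  "graded_ideal I \<longleftrightarrow> pr.subspace I \<and> (\<forall>p\<in>I. \<forall>e. hcomp e p \<in> I)"

text \<open>A graded free resolution of $R/I$ for a homogeneous ideal \<open>I\<close>, not necessarily minimal.\<close>

locale resolution =
  fixes I :: "('a::finite, 'k::comm_ring_1) mpoly set" and b \<phi> \<epsilon>
  assumes res: "graded_free_resolution I b \<phi> \<epsilon>" and graded: "graded_ideal I"
begin

lemma hom_aug: "module_hom smult (*) \<epsilon>"
  using res by (simp add: graded_free_resolution_def)

lemma aug_graded: "x \<in> free_module (b 0) \<Longrightarrow> fhomogeneous e x \<Longrightarrow> homogeneous e (\<epsilon> x)"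
  using res by (simp add: graded_free_resolution_def)

lemma hom_diff: "module_hom smult smult (\<phi> r)"
  using res by (simp add: graded_free_resolution_def)

lemma diff_in: "x \<in> free_module (b (Suc r)) \<Longrightarrow> \<phi> r x \<in> free_module (b r)"
  using res by (simp add: graded_free_resolution_def image_subset_iff)

lemma diff_graded: "x \<in> free_module (b (Suc r)) \<Longrightarrow> fhomogeneous e x \<Longrightarrow> fhomogeneous e (\<phi> r x)"
  using res by (simp add: graded_free_resolution_def)

lemma aug_onto: "\<exists>x\<in>free_module (b 0). p - \<epsilon> x \<in> I"
  using res by (simp add: graded_free_resolution_def)

lemma exact_aug: "x \<in> free_module (b 0) \<Longrightarrow> x \<in> \<phi> 0 ` free_module (b 1) \<longleftrightarrow> \<epsilon> x \<in> I"
proof -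
  have "{x \<in> free_module (b 0). \<epsilon> x \<in> I} = \<phi> 0 ` free_module (b 1)"
    using res unfolding graded_free_resolution_def by (elim conjE)
  then show "x \<in> free_module (b 0) \<Longrightarrow> x \<in> \<phi> 0 ` free_module (b 1) \<longleftrightarrow> \<epsilon> x \<in> I" by blast
qed

lemma exact: "x \<in> free_module (b (Suc r)) \<Longrightarrow>
    x \<in> \<phi> (Suc r) ` free_module (b (Suc (Suc r))) \<longleftrightarrow> \<phi> r x = 0"
proof -
  have "\<forall>r. {x \<in> free_module (b (Suc r)). \<phi> r x = 0} = \<phi> (Suc r) ` free_module (b (Suc (Suc r)))"
    using res unfolding graded_free_resolution_def by (elim conjE)
  then show "x \<in> free_module (b (Suc r)) \<Longrightarrow>
    x \<in> \<phi> (Suc r) ` free_module (b (Suc (Suc r))) \<longleftrightarrow> \<phi> r x = 0" by blast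
qed

lemma diff_diff: "x \<in> free_module (b (Suc (Suc r))) \<Longrightarrow> \<phi> r (\<phi> (Suc r) x) = 0"
  using exact[OF diff_in, of x r] by auto

lemma aug_diff: "x \<in> free_module (b (Suc 0)) \<Longrightarrow> \<epsilon> (\<phi> 0 x) \<in> I"
  using exact_aug[OF diff_in, of x] by auto

lemma subspace_I: "pr.subspace I"
  using graded by (simp add: graded_ideal_def)

lemma aug_onto_homogeneous:
  assumes "homogeneous e p"
  shows "\<exists>x\<in>free_module (b 0). p - \<epsilon> x \<in> I \<and> fhomogeneous e x"
proof -
  obtain x where x: "x \<in> free_module (b 0)" "p - \<epsilon> x \<in> I" using aug_onto by blast
  then have "hcomp e (p - \<epsilon> x) \<in> I" using graded by (auto simp: graded_ideal_def)
  moreover have "hcomp e (\<epsilon> x) = \<epsilon> (fcomp e x)" using hom_aug aug_graded x by (intro hcomp_hom)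
  ultimately show ?thesis using assms x
    by (intro bexI[of _ "fcomp e x"])
      (auto simp: hcomp_diff hcomp_homogeneous fcomp_in_free_module fhomogeneous_fcomp)
qed

end

text \<open>Multiplication by a homogeneous \<open>f\<close> with $f I' \subseteq I$ lifts to a graded map of
  resolutions.\<close>

lemma comparison:
  fixes \<epsilon> \<epsilon>' :: "('a::finite, 'k::comm_ring_1) fvec \<Rightarrow> ('a, 'k) mpoly"
  assumes R': "resolution I' b' \<phi>' \<epsilon>'" and R: "resolution I b \<phi> \<epsilon>"
    and f: "homogeneous s f" "\<And>p. p \<in> I' \<Longrightarrow> f * p \<in> I"
  obtains \<psi> where "\<And>r. module_hom smult smult (\<psi> r)"
    "\<And>r x. x \<in> free_module (b' r) \<Longrightarrow> \<psi> r x \<in> free_module (b r)"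
    "\<And>r e x. x \<in> free_module (b' r) \<Longrightarrow> fhomogeneous e x \<Longrightarrow> fhomogeneous (e + s) (\<psi> r x)"
    "\<And>x. x \<in> free_module (b' 0) \<Longrightarrow> \<epsilon> (\<psi> 0 x) - f * \<epsilon>' x \<in> I"
    "\<And>r x. x \<in> free_module (b' (Suc r)) \<Longrightarrow> \<phi> r (\<psi> (Suc r) x) = \<psi> r (\<phi>' r x)"
proof -
  interpret R': resolution I' b' \<phi>' \<epsilon>' by fact
  interpret R: resolution I b \<phi> \<epsilon> by fact
  \<comment> \<open>The last conjunct of \<open>P\<close> is what makes the next lifting step possible.\<close>
  define P where "P r \<psi> \<longleftrightarrow> module_hom smult smult \<psi> \<and> \<psi> ` free_module (b' r) \<subseteq> free_module (b r) \<and>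
      (\<forall>i\<in>basis (b' r). fhomogeneous (fst i + s) (\<psi> (unit i))) \<and>
      (r = 0 \<longrightarrow> (\<forall>x\<in>free_module (b' 0). \<epsilon> (\<psi> x) - f * \<epsilon>' x \<in> I)) \<and>
      (\<forall>x\<in>free_module (b' (Suc r)). \<psi> (\<phi>' r x) \<in> \<phi> r ` free_module (b (Suc r)))"
    for r and \<psi> :: "('a, 'k) fvec \<Rightarrow> ('a, 'k) fvec"
  define Q where "Q r \<psi> \<psi>' \<longleftrightarrow> (\<forall>x\<in>free_module (b' (Suc r)). \<phi> r (\<psi>' x) = \<psi> (\<phi>' r x))"
    for r and \<psi> \<psi>' :: "('a, 'k) fvec \<Rightarrow> ('a, 'k) fvec"
  have "\<exists>\<psi>. P 0 \<psi>"
  proof -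
    have "\<exists>y\<in>free_module (b 0). f * \<epsilon>' (unit i) - \<epsilon> y \<in> I \<and> fhomogeneous (fst i + s) y"
      if i: "i \<in> basis (b' 0)" for i
      using homogeneous_mult[OF f(1) R'.aug_graded[OF unit_in_free_module[OF i] fhomogeneous_unit]]
      by (intro R.aug_onto_homogeneous) (simp only: add.commute[of s])
    then obtain y where y: "\<And>i. i \<in> basis (b' 0) \<Longrightarrow> y i \<in> free_module (b 0)"
      "\<And>i. i \<in> basis (b' 0) \<Longrightarrow> f * \<epsilon>' (unit i) - \<epsilon> (y i) \<in> I"
      "\<And>i. i \<in> basis (b' 0) \<Longrightarrow> fhomogeneous (fst i + s) (y i)"
      by metis
    interpret e': module_hom smult "(*)" \<epsilon>' by (rule R'.hom_aug)
    interpret e: module_hom smult "(*)" \<epsilon> by (rule R.hom_aug)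
    interpret l: module_hom smult smult "lin y" by (rule hom_lin)
    have sub: "fv.subspace {x. \<epsilon> (lin y x) - f * \<epsilon>' x \<in> I}"
    proof (rule fv.subspaceI)
      show "0 \<in> {x. \<epsilon> (lin y x) - f * \<epsilon>' x \<in> I}"
        using R.subspace_I by (simp add: pr.subspace_def)
    next
      fix x z assume "x \<in> {x. \<epsilon> (lin y x) - f * \<epsilon>' x \<in> I}" "z \<in> {x. \<epsilon> (lin y x) - f * \<epsilon>' x \<in> I}"
      then have "(\<epsilon> (lin y x) - f * \<epsilon>' x) + (\<epsilon> (lin y z) - f * \<epsilon>' z) \<in> I"
        using R.subspace_I by (auto simp: pr.subspace_def)
      then show "x + z \<in> {x. \<epsilon> (lin y x) - f * \<epsilon>' x \<in> I}"
        by (simp add: e.add e'.add l.add algebra_simps)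
    next
      fix c x assume "x \<in> {x. \<epsilon> (lin y x) - f * \<epsilon>' x \<in> I}"
      then have "c * (\<epsilon> (lin y x) - f * \<epsilon>' x) \<in> I"
        using R.subspace_I by (auto simp: pr.subspace_def)
      then show "smult c x \<in> {x. \<epsilon> (lin y x) - f * \<epsilon>' x \<in> I}"
        by (simp only: e.scale e'.scale l.scale right_diff_distrib mult.left_commute mem_Collect_eq)
    qed
    have unit: "unit i \<in> {x. \<epsilon> (lin y x) - f * \<epsilon>' x \<in> I}" if "i \<in> basis (b' 0)" for i
      using pr.subspace_neg[OF R.subspace_I y(2)[OF that]] by simp
    have c: "\<epsilon> (lin y x) - f * \<epsilon>' x \<in> I" if "x \<in> free_module (b' 0)" for x
      using free_module_induct[OF sub unit that] by simp
    have l: "lin y x \<in> free_module (b 0)" if "x \<in> free_module (b' 0)" for x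
    proof -
      have "lin y ` free_module (b' 0) \<subseteq> free_module (b 0)"
        using y(1) by (intro hom_maps_free_module hom_lin subspace_free_module) simp
      with that show ?thesis by blast
    qed
    have "lin y (\<phi>' 0 x) \<in> \<phi> 0 ` free_module (b (Suc 0))" if x: "x \<in> free_module (b' (Suc 0))" for x
    proof -
      have "\<epsilon> (lin y (\<phi>' 0 x)) - f * \<epsilon>' (\<phi>' 0 x) \<in> I" by (rule c[OF R'.diff_in[OF x]])
      moreover have "f * \<epsilon>' (\<phi>' 0 x) \<in> I" by (rule f(2)[OF R'.aug_diff[OF x]])
      ultimately have "\<epsilon> (lin y (\<phi>' 0 x)) - f * \<epsilon>' (\<phi>' 0 x) + f * \<epsilon>' (\<phi>' 0 x) \<in> I"
        by (rule pr.subspace_add[OF R.subspace_I])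
      then show ?thesis using R.exact_aug[OF l[OF R'.diff_in[OF x]]] by simp
    qed
    then have "P 0 (lin y)" unfolding P_def using hom_lin c l y(3) by (simp add: image_subset_iff)
    then show ?thesis by blast
  qed
  moreover have "\<exists>\<psi>'. P (Suc r) \<psi>' \<and> Q r \<psi> \<psi>'" if P: "P r \<psi>" for r \<psi>
  proof -
    interpret psi: module_hom smult smult \<psi> using P by (simp add: P_def)
    have gr: "fhomogeneous (e + s) (\<psi> x)" if "x \<in> free_module (b' r)" "fhomogeneous e x" for e x
      using graded_hom[OF psi.module_hom_axioms _ that] P by (simp add: P_def)
    have hom: "module_hom smult smult (\<psi> \<circ> \<phi>' r)"
      by (rule module_hom_compose[OF R'.hom_diff psi.module_hom_axioms])
    have *: "\<exists>y\<in>free_module (b (Suc r)). \<phi> r y = (\<psi> \<circ> \<phi>' r) (unit i) \<and> fhomogeneous (fst i + s) y"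
      if i: "i \<in> basis (b' (Suc r))" for i
    proof (rule homogeneous_preimage)
      show "(\<psi> \<circ> \<phi>' r) (unit i) \<in> \<phi> r ` free_module (b (Suc r))"
        using P unit_in_free_module[OF i] by (auto simp: P_def)
      show "fhomogeneous (fst i + s) ((\<psi> \<circ> \<phi>' r) (unit i))"
        by (simp add: gr R'.diff_in R'.diff_graded unit_in_free_module i fhomogeneous_unit)
    qed (fact R.hom_diff R.diff_graded)+
    obtain \<psi>' where \<psi>': "module_hom smult smult \<psi>'"
      "\<psi>' ` free_module (b' (Suc r)) \<subseteq> free_module (b (Suc r))"
      "\<forall>x\<in>free_module (b' (Suc r)). \<phi> r (\<psi>' x) = (\<psi> \<circ> \<phi>' r) x"
      "\<forall>i\<in>basis (b' (Suc r)). fhomogeneous (fst i + s) (\<psi>' (unit i))"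
      by (rule exE[OF lift_on_basis[where b = "b' (Suc r)" and Q = "\<lambda>i y. fhomogeneous (fst i + s) y", OF R.hom_diff hom]], erule *, elim conjE, rule that)
    have "\<psi>' (\<phi>' (Suc r) x) \<in> \<phi> (Suc r) ` free_module (b (Suc (Suc r)))"
      if x: "x \<in> free_module (b' (Suc (Suc r)))" for x
    proof -
      have "\<phi> r (\<psi>' (\<phi>' (Suc r) x)) = \<psi> (\<phi>' r (\<phi>' (Suc r) x))"
        using \<psi>'(3) R'.diff_in[OF x] by simp
      also have "\<dots> = 0" by (simp add: R'.diff_diff[OF x])
      finally show ?thesis using \<psi>'(2) R'.diff_in[OF x] by (subst R.exact) auto
    qed
    with \<psi>' have "P (Suc r) \<psi>' \<and> Q r \<psi> \<psi>'" by (auto simp: P_def Q_def)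
    then show ?thesis by blast
  qed
  ultimately have "\<exists>\<psi>. \<forall>r. P r (\<psi> r) \<and> Q r (\<psi> r) (\<psi> (Suc r))"
    by (rule dependent_nat_choice[of P Q])
  then obtain \<psi> where \<psi>: "\<And>r. P r (\<psi> r)" "\<And>r. Q r (\<psi> r) (\<psi> (Suc r))" by blast
  show ?thesis
  proof (rule that)
    fix r e and x :: "('a, 'k) fvec"
    show hom: "module_hom smult smult (\<psi> r)"
      using \<psi>(1)[of r] by (simp add: P_def)
    assume x: "x \<in> free_module (b' r)"
    then show "\<psi> r x \<in> free_module (b r)"
      using \<psi>(1)[of r] by (auto simp: P_def)
    show "fhomogeneous (e + s) (\<psi> r x)" if "fhomogeneous e x"
      using graded_hom[OF hom _ x that] \<psi>(1)[of r] by (simp add: P_def)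
  next
    fix x :: "('a, 'k) fvec" assume "x \<in> free_module (b' 0)"
    then show "\<epsilon> (\<psi> 0 x) - f * \<epsilon>' x \<in> I" using \<psi>(1)[of 0] by (simp add: P_def)
  next
    fix r and x :: "('a, 'k) fvec" assume "x \<in> free_module (b' (Suc r))"
    then show "\<phi> r (\<psi> (Suc r) x) = \<psi> r (\<phi>' r x)" using \<psi>(2)[of r] by (simp add: Q_def)
  qed
qed

text \<open>An endomorphism of a minimal resolution that induces zero on $R/I$ is null homotopic, and
  therefore zero modulo $\mathfrak{m}$.\<close>

lemma null_homotopic_mvec:
  fixes \<epsilon> :: "('a::finite, 'k::comm_ring_1) fvec \<Rightarrow> ('a, 'k) mpoly"
  assumes R: "resolution I b \<phi> \<epsilon>"
    and min: "\<And>r x. x \<in> free_module (b (Suc r)) \<Longrightarrow> mvec (\<phi> r x)"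
    and hom: "\<And>r. module_hom smult smult (\<kappa> r)"
    and maps: "\<And>r x. x \<in> free_module (b r) \<Longrightarrow> \<kappa> r x \<in> free_module (b r)"
    and zero: "\<And>x. x \<in> free_module (b 0) \<Longrightarrow> \<epsilon> (\<kappa> 0 x) \<in> I"
    and chain: "\<And>r x. x \<in> free_module (b (Suc r)) \<Longrightarrow> \<phi> r (\<kappa> (Suc r) x) = \<kappa> r (\<phi> r x)"
    and x: "x \<in> free_module (b r)"
  shows "mvec (\<kappa> r x)"
proof -
  interpret R: resolution I b \<phi> \<epsilon> by fact
  \<comment> \<open>\<open>\<sigma>\<close> is the component of a homotopy in degree \<open>r\<close>.\<close>
  define P where "P r \<sigma> \<longleftrightarrow> module_hom smult smult \<sigma> \<and> \<sigma> ` free_module (b r) \<subseteq> free_module (b (Suc r)) \<and>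
      (\<forall>x\<in>free_module (b r). mvec (\<kappa> r x)) \<and>
      (\<forall>x\<in>free_module (b (Suc r)). \<phi> r (\<kappa> (Suc r) x - \<sigma> (\<phi> r x)) = 0)"
    for r and \<sigma> :: "('a, 'k) fvec \<Rightarrow> ('a, 'k) fvec"
  have "\<exists>\<sigma>. P r \<sigma>" for r
  proof (induction r)
    case 0
    have *: "\<exists>y\<in>free_module (b (Suc 0)). \<phi> 0 y = \<kappa> 0 (unit i) \<and> True" if i: "i \<in> basis (b 0)" for i
      using R.exact_aug[OF maps[OF unit_in_free_module[OF i]]] zero[OF unit_in_free_module[OF i]] by auto
    obtain \<sigma> where \<sigma>: "module_hom smult smult \<sigma>"
      "\<sigma> ` free_module (b 0) \<subseteq> free_module (b (Suc 0))"
      "\<forall>x\<in>free_module (b 0). \<phi> 0 (\<sigma> x) = \<kappa> 0 x"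
      by (rule exE[OF lift_on_basis[where b = "b 0" and Q = "\<lambda>_ _. True", OF R.hom_diff hom]], erule *, elim conjE, rule that)
    interpret phi: module_hom smult smult "\<phi> 0" by (rule R.hom_diff)
    have "\<phi> 0 (\<kappa> (Suc 0) x - \<sigma> (\<phi> 0 x)) = 0" if "x \<in> free_module (b (Suc 0))" for x
      using chain[OF that] \<sigma>(3)[THEN bspec, OF R.diff_in[OF that]] by (simp add: phi.diff)
    moreover have "mvec (\<kappa> 0 x)" if "x \<in> free_module (b 0)" for x
      using min[of "\<sigma> x" 0] \<sigma> that by auto
    ultimately show ?case using \<sigma> by (auto simp: P_def)
  next
    case (Suc r)
    then obtain \<sigma> where \<sigma>: "P r \<sigma>" ..
    interpret s: module_hom smult smult \<sigma> using \<sigma> by (simp add: P_def)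
    interpret k: module_hom smult smult "\<kappa> (Suc r)" by (rule hom)
    interpret p: module_hom smult smult "\<phi> r" by (rule R.hom_diff)
    interpret p': module_hom smult smult "\<phi> (Suc r)" by (rule R.hom_diff)
    have hom': "module_hom smult smult (\<lambda>x. \<kappa> (Suc r) x - \<sigma> (\<phi> r x))"
      by unfold_locales (simp_all add: s.add s.scale k.add k.scale p.add p.scale fv.scale_right_diff_distrib)
    have in_free: "\<kappa> (Suc r) x - \<sigma> (\<phi> r x) \<in> free_module (b (Suc r))"
      if "x \<in> free_module (b (Suc r))" for x
      using \<sigma> maps[OF that] R.diff_in[OF that]
      by (intro fv.subspace_diff subspace_free_module) (auto simp: P_def)
    have *: "\<exists>y\<in>free_module (b (Suc (Suc r))). \<phi> (Suc r) y = \<kappa> (Suc r) (unit i) - \<sigma> (\<phi> r (unit i)) \<and> True"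
      if i: "i \<in> basis (b (Suc r))" for i
      using R.exact[OF in_free[OF unit_in_free_module[OF i]]] unit_in_free_module[OF i] \<sigma>
      by (auto simp: P_def)
    obtain \<tau> where \<tau>: "module_hom smult smult \<tau>"
      "\<tau> ` free_module (b (Suc r)) \<subseteq> free_module (b (Suc (Suc r)))"
      "\<forall>x\<in>free_module (b (Suc r)). \<phi> (Suc r) (\<tau> x) = \<kappa> (Suc r) x - \<sigma> (\<phi> r x)"
      by (rule exE[OF lift_on_basis[where b = "b (Suc r)" and Q = "\<lambda>_ _. True", OF R.hom_diff hom']], erule *, elim conjE, rule that)
    have "\<phi> (Suc r) (\<kappa> (Suc (Suc r)) x - \<tau> (\<phi> (Suc r) x)) = 0" if "x \<in> free_module (b (Suc (Suc r)))" for x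
      using chain[OF that] \<tau>(3)[THEN bspec, OF R.diff_in[OF that]] R.diff_diff[OF that] by (simp add: p'.diff)
    moreover have "mvec (\<kappa> (Suc r) x)" if x: "x \<in> free_module (b (Suc r))" for x
    proof -
      have "mvec (\<phi> (Suc r) (\<tau> x))" using min \<tau>(2) x by blast
      moreover have "mvec (\<sigma> (\<phi> r x))" using mvec_hom[OF s.module_hom_axioms min[OF x]] .
      moreover have "\<kappa> (Suc r) x = \<phi> (Suc r) (\<tau> x) + \<sigma> (\<phi> r x)" using \<tau>(3)[THEN bspec, OF x] by simp
      ultimately show ?thesis using fv.subspace_add[OF subspace_mvec] by auto
    qed
    ultimately show ?case using \<tau> by (auto simp: P_def)
  qed
  with x show ?thesis by (auto simp: P_def)
qed

section \<open>Uniqueness of graded Betti numbers\<close>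

text \<open>The scalar multiplication that makes a free module a vector space.\<close>

definition kscale :: "'k \<Rightarrow> ('a, 'k::field) fvec \<Rightarrow> ('a, 'k) fvec" where
  "kscale c x = smult (single 0 c) x"

lemma lookup_kscale:
  fixes x :: "('a, 'k::field) fvec"
  shows "lookup (lookup (kscale c x) i) m = c * lookup (lookup x i) m"
proof -
  have "single 0 c * p = Poly_Mapping.map ((*) c) p" for p :: "('a, 'k) mpoly"
    by (simp add: mult_map_scale_conv_mult)
  then show ?thesis by (simp add: kscale_def lookup_smult Poly_Mapping.map.rep_eq when_def)
qed

interpretation ks: vector_space "kscale :: 'k::field \<Rightarrow> ('a, 'k) fvec \<Rightarrow> ('a, 'k) fvec"
  by unfold_locales
    (rule fvec_eqI2, simp add: lookup_kscale lookup_add distrib_left distrib_right mult.assoc)+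

lemma subspace_imp_ksubspace: "fv.subspace M \<Longrightarrow> ks.subspace M"
  by (simp add: fv.subspace_def ks.subspace_def kscale_def)

lemma ksubspace_fhomogeneous: "ks.subspace {x. fhomogeneous e x}"
  by (auto simp: ks.subspace_def fhomogeneous_add) (simp add: fhomogeneous_iff lookup_kscale)

text \<open>The constant part of every coefficient, i.e. the reduction modulo $\mathfrak{m}$.\<close>

definition cpart :: "('a, 'k::field) fvec \<Rightarrow> ('a, 'k) fvec" where
  "cpart x = Poly_Mapping.map (\<lambda>p. single 0 (lookup p 0)) x"

lemma lookup_cpart: "lookup (cpart x) i = single 0 (lookup (lookup x i) 0)"
  by (simp add: cpart_def Poly_Mapping.map.rep_eq when_def)

lemma cpart_eq_0_iff:
  fixes x :: "('a, 'k::field) fvec"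
  shows "cpart x = 0 \<longleftrightarrow> mvec x"
proof
  assume "cpart x = 0"
  then have "single 0 (lookup (lookup x i) 0) = (0 :: ('a, 'k) mpoly)" for i
    by (metis lookup_cpart lookup_zero)
  then show "mvec x" unfolding mvec_def by (metis lookup_single_eq lookup_zero)
next
  assume "mvec x"
  then show "cpart x = 0" by (intro poly_mapping_eqI) (simp add: lookup_cpart mvec_def)
qed

lemma cpart_linear_part:
  assumes "module_hom smult smult h"
  shows "Vector_Spaces.linear kscale kscale (\<lambda>x. cpart (h x))"
proof -
  interpret h: module_hom smult smult h by fact
  show ?thesis
    by unfold_locales
      (auto intro!: fvec_eqI simp: lookup_cpart h.add h.scale kscale_def lookup_add lookup_smult
        lookup_mult_0 single_add mult_single)
qed

text \<open>With \<open>f\<close> and \<open>g\<close> lifting the identity in both directions, \<open>g \<circ> f\<close> is the identity modulo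
  $\mathfrak{m}$.  So \<open>f\<close> induces an injective linear map from the span of the basis elements of degree
  \<open>d\<close> in $F_r$ to that in $F'_r$.\<close>

lemma betti_le:
  fixes I :: "('a::finite, 'k::field) mpoly set"
  assumes R: "resolution I b \<phi> \<epsilon>" and R': "resolution I b' \<phi>' \<epsilon>'"
    and min: "\<And>r x. x \<in> free_module (b (Suc r)) \<Longrightarrow> mvec (\<phi> r x)"
  shows "b r d \<le> b' r d"
proof -
  interpret R: resolution I b \<phi> \<epsilon> by fact
  interpret R': resolution I b' \<phi>' \<epsilon>' by fact
  have one: "homogeneous 0 (1 :: ('a, 'k) mpoly)" by (simp add: homogeneous_def)
  obtain f where f: "\<And>r. module_hom smult smult (f r)"
    "\<And>r x. x \<in> free_module (b r) \<Longrightarrow> f r x \<in> free_module (b' r)"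
    "\<And>r e x. x \<in> free_module (b r) \<Longrightarrow> fhomogeneous e x \<Longrightarrow> fhomogeneous (e + 0) (f r x)"
    "\<And>x. x \<in> free_module (b 0) \<Longrightarrow> \<epsilon>' (f 0 x) - 1 * \<epsilon> x \<in> I"
    "\<And>r x. x \<in> free_module (b (Suc r)) \<Longrightarrow> \<phi>' r (f (Suc r) x) = f r (\<phi> r x)"
    by (rule comparison[OF R R' one]) auto
  obtain g where g: "\<And>r. module_hom smult smult (g r)"
    "\<And>r x. x \<in> free_module (b' r) \<Longrightarrow> g r x \<in> free_module (b r)"
    "\<And>r e x. x \<in> free_module (b' r) \<Longrightarrow> fhomogeneous e x \<Longrightarrow> fhomogeneous (e + 0) (g r x)"
    "\<And>x. x \<in> free_module (b' 0) \<Longrightarrow> \<epsilon> (g 0 x) - 1 * \<epsilon>' x \<in> I"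
    "\<And>r x. x \<in> free_module (b' (Suc r)) \<Longrightarrow> \<phi> r (g (Suc r) x) = g r (\<phi>' r x)"
    by (rule comparison[OF R' R one]) auto
  define \<kappa> where "\<kappa> r x = g r (f r x) - x" for r x
  have m: "mvec (\<kappa> r x)" if "x \<in> free_module (b r)" for x r
  proof (rule null_homotopic_mvec[OF R min _ _ _ _ that])
    fix r
    interpret f: module_hom smult smult "f r" by (rule f(1))
    interpret g: module_hom smult smult "g r" by (rule g(1))
    show "module_hom smult smult (\<kappa> r)"
      unfolding \<kappa>_def
      by unfold_locales (simp_all add: f.add g.add f.scale g.scale fv.scale_right_diff_distrib)
  next
    fix r and x :: "('a, 'k) fvec" assume "x \<in> free_module (b r)"
    then show "\<kappa> r x \<in> free_module (b r)"
      unfolding \<kappa>_def by (intro fv.subspace_diff[OF subspace_free_module] g(2) f(2))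
  next
    fix x :: "('a, 'k) fvec" assume x: "x \<in> free_module (b 0)"
    interpret e: module_hom smult "(*)" \<epsilon> by (rule R.hom_aug)
    have "(\<epsilon> (g 0 (f 0 x)) - 1 * \<epsilon>' (f 0 x)) + (\<epsilon>' (f 0 x) - 1 * \<epsilon> x) \<in> I"
      by (intro pr.subspace_add[OF R.subspace_I] g(4) f(4) f(2) x)
    then show "\<epsilon> (\<kappa> 0 x) \<in> I" by (simp add: \<kappa>_def e.diff)
  next
    fix r and x :: "('a, 'k) fvec" assume x: "x \<in> free_module (b (Suc r))"
    interpret p: module_hom smult smult "\<phi> r" by (rule R.hom_diff)
    show "\<phi> r (\<kappa> (Suc r) x) = \<kappa> r (\<phi> r x)"
      using g(5)[OF f(2)[OF x]] f(5)[OF x] by (simp add: \<kappa>_def p.diff)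
  qed
  \<comment> \<open>The map induced by \<open>f\<close> modulo $\mathfrak{m}$, on the span of the basis elements of degree \<open>d\<close>.\<close>
  define h where "h x = cpart (f r x)" for x
  define E :: "('a, 'k) fvec set" where "E = (\<lambda>k. unit (d, k)) ` {..<b r d}"
  define E' :: "('a, 'k) fvec set" where "E' = (\<lambda>k. unit (d, k)) ` {..<b' r d}"
  have inj: "inj (\<lambda>k. unit (d, k) :: ('a, 'k) fvec)"
    by (rule injI) (metis lookup_single_eq lookup_single_not_eq one_neq_zero Pair_inject)
  have lin: "Vector_Spaces.linear kscale kscale h" unfolding h_def by (rule cpart_linear_part[OF f(1)])
  interpret h: Vector_Spaces.linear kscale kscale h by fact
  have E_free: "ks.span E \<subseteq> free_module (b r)"
    by (rule ks.span_minimal[OF _ subspace_imp_ksubspace[OF subspace_free_module]])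
      (auto simp: E_def basis_def intro!: unit_in_free_module)
  have E_const: "ks.span E \<subseteq> {x. \<forall>i m. m \<noteq> 0 \<longrightarrow> lookup (lookup x i) m = 0}"
    by (rule ks.span_minimal)
      (auto simp: E_def ks.subspace_def lookup_kscale lookup_add lookup_single when_def lookup_one)
  have indep: "ks.independent E"
  proof (rule ks.independent_if_scalars_zero)
    show "finite E" by (simp add: E_def)
    fix a x assume 0: "(\<Sum>x\<in>E. kscale (a x) x) = 0" and x: "x \<in> E"
    then obtain k where k: "k < b r d" "x = unit (d, k)" by (auto simp: E_def)
    have "(0 :: ('a, 'k) fvec) = (\<Sum>l<b r d. kscale (a (unit (d, l))) (unit (d, l)))"
      using 0 by (simp add: E_def sum.reindex[OF inj_on_subset[OF inj]])
    then have "0 = lookup (lookup (\<Sum>l<b r d. kscale (a (unit (d, l))) (unit (d, l)) :: ('a, 'k) fvec) (d, k)) 0"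
      by (metis lookup_zero)
    also have "\<dots> = (\<Sum>l<b r d. if l = k then a x else 0)"
      unfolding lookup_sum lookup_kscale
      by (intro sum.cong) (auto simp: lookup_single when_def k)
    finally show "a x = 0" using k by simp
  qed
  have inj_h: "inj_on h (ks.span E)"
    unfolding h.inj_on_iff_eq_0[OF ks.subspace_span]
  proof (intro ballI impI)
    fix x assume x: "x \<in> ks.span E" and "h x = 0"
    then have "mvec (f r x)" by (simp add: h_def cpart_eq_0_iff)
    then have "mvec (g r (f r x))" by (rule mvec_hom[OF g(1)])
    moreover have "mvec (\<kappa> r x)" using m E_free x by auto
    ultimately have "mvec (g r (f r x) - \<kappa> r x)"
      using fv.subspace_diff[OF subspace_mvec] by auto
    then have "mvec x" by (simp add: \<kappa>_def)
    then have "lookup (lookup x i) m = 0" for i m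
      using E_const x by (cases "m = 0") (auto simp: mvec_def)
    then show "x = 0" by (intro fvec_eqI2) simp
  qed
  then have "ks.independent (h ` E)" by (rule h.independent_injective_image[OF indep])
  moreover have "h ` E \<subseteq> ks.span E'"
  proof
    fix y assume "y \<in> h ` E"
    then obtain k where k: "k < b r d" "y = h (unit (d, k))" by (auto simp: E_def)
    have u: "unit (d, k) \<in> free_module (b r)" using k by (intro unit_in_free_module) (simp add: basis_def)
    let ?z = "f r (unit (d, k))"
    have z: "?z \<in> free_module (b' r)" "fhomogeneous d ?z"
      using f(2)[OF u] f(3)[OF u fhomogeneous_unit] by auto
    have y: "y = (\<Sum>l<b' r d. kscale (lookup (lookup ?z (d, l)) 0) (unit (d, l)))"
    proof (rule fvec_eqI2)
      fix i and m :: "'a \<Rightarrow>\<^sub>0 nat"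
      have "lookup (lookup (\<Sum>l<b' r d. kscale (lookup (lookup ?z (d, l)) 0) (unit (d, l))) i) m
        = (\<Sum>l<b' r d. if l = snd i then if fst i = d \<and> m = 0 then lookup (lookup ?z i) 0 else 0 else 0)"
        unfolding lookup_sum lookup_kscale
        by (intro sum.cong) (auto simp: lookup_single when_def lookup_one)
      also have "\<dots> = (if snd i < b' r d \<and> fst i = d \<and> m = 0 then lookup (lookup ?z i) 0 else 0)"
        by simp
      also have "\<dots> = (if m = 0 then lookup (lookup ?z i) 0 else 0)"
      \<comment> \<open>A nonzero constant coefficient of a homogeneous element sits at a basis element of the same degree.\<close>
      proof (cases "lookup (lookup ?z i) 0 = 0")
        case False
        then have "fst i = d" using z(2) by (force simp: fhomogeneous_iff)
        moreover have "lookup ?z i \<noteq> 0" using False by auto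
        then have "i \<in> basis (b' r)" using z(1) by (auto simp: free_module_iff_lookup)
        ultimately show ?thesis by (auto simp: basis_def)
      qed auto
      finally show "lookup (lookup y i) m =
          lookup (lookup (\<Sum>l<b' r d. kscale (lookup (lookup ?z (d, l)) 0) (unit (d, l))) i) m"
        by (auto simp: k h_def lookup_cpart lookup_single when_def)
    qed
    also have "\<dots> \<in> ks.span E'"
      by (intro ks.span_sum ks.span_scale) (auto simp: E'_def intro: ks.span_base)
    finally show "y \<in> ks.span E'" .
  qed
  ultimately have "card (h ` E) \<le> card E'"
    using ks.independent_span_bound[of E' "h ` E"] by (simp add: E'_def)
  moreover have "card (h ` E) = card E"
    by (rule card_image[OF inj_on_subset[OF inj_h ks.span_superset]])
  ultimately show ?thesis
    by (simp add: E_def E'_def card_image inj_on_subset[OF inj])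
qed

section \<open>Existence of minimal resolutions\<close>

lemma finite_monoms: "finite {m :: 'a::finite \<Rightarrow>\<^sub>0 nat. monom_degree m \<le> e}"
proof (rule finite_imageD)
  have "lookup m x \<le> monom_degree m" for m :: "'a \<Rightarrow>\<^sub>0 nat" and x
    unfolding monom_degree_eq by (rule member_le_sum) auto
  then have "lookup ` {m :: 'a \<Rightarrow>\<^sub>0 nat. monom_degree m \<le> e} \<subseteq>
      {f. \<forall>x. (x \<in> UNIV \<longrightarrow> f x \<in> {..e}) \<and> (x \<notin> UNIV \<longrightarrow> f x = 0)}"
    by (auto intro: order_trans)
  moreover have "finite {f :: 'a \<Rightarrow> nat. \<forall>x. (x \<in> UNIV \<longrightarrow> f x \<in> {..e}) \<and> (x \<notin> UNIV \<longrightarrow> f x = 0)}"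
    by (rule finite_set_of_finite_funs) auto
  ultimately show "finite (lookup ` {m :: 'a \<Rightarrow>\<^sub>0 nat. monom_degree m \<le> e})"
    by (rule finite_subset)
  show "inj_on lookup {m :: 'a \<Rightarrow>\<^sub>0 nat. monom_degree m \<le> e}"
    by (rule inj_onI) (rule poly_mapping_eq_iff[THEN iffD2])
qed

lemma homogeneous_part_finite_dim:
  obtains S :: "('a::finite, 'k::field) fvec set" where "finite S"
    "{x \<in> free_module b. fhomogeneous e x} \<subseteq> ks.span S"
proof
  define mons :: "('a \<Rightarrow>\<^sub>0 nat) set" where "mons = {m. monom_degree m \<le> e}"
  define S :: "('a, 'k) fvec set" where
    "S = (\<lambda>(i, m). smult (single m 1) (unit i)) ` ((SIGMA d:{..e}. {..<b d}) \<times> mons)"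
  show "finite S"
    using finite_monoms by (auto simp: S_def mons_def)
  show "{x \<in> free_module b. fhomogeneous e x} \<subseteq> ks.span S"
  proof safe
    fix x :: "('a, 'k) fvec"
    assume x: "x \<in> free_module b" "fhomogeneous e x"
    have "smult (single m c) (unit i) = kscale c (smult (single m 1) (unit i) :: ('a, 'k) fvec)" for m c i
      by (simp add: kscale_def mult_single)
    moreover have "smult (single m 1) (unit i) \<in> S" if "i \<in> keys x" "m \<in> keys (lookup x i)" for i m
    proof -
      have "monom_degree m + fst i = e" using that x(2) by (auto simp: fhomogeneous_iff in_keys_iff)
      moreover have "snd i < b (fst i)"
        using that(1) x(1) by (auto simp: free_module_iff basis_def)
      ultimately have "(i, m) \<in> (SIGMA d:{..e}. {..<b d}) \<times> mons"
        by (cases i) (auto simp: mons_def)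
      then show ?thesis unfolding S_def by (intro image_eqI[of _ _ "(i, m)"]) auto
    qed
    ultimately have "smult (single m c) (unit i) \<in> ks.span S"
      if "i \<in> keys x" "m \<in> keys (lookup x i)" for i m c
      using that by (metis ks.span_scale ks.span_base)
    then have "(\<Sum>m\<in>keys (lookup x i). smult (single m (lookup (lookup x i) m)) (unit i)) \<in> ks.span S"
      if "i \<in> keys x" for i
      using that by (intro ks.span_sum)
    then have "(\<Sum>i\<in>keys x. smult (lookup x i) (unit i)) \<in> ks.span S"
      by (intro ks.span_sum) (simp add: poly_mapping_expand flip: fv.scale_sum_left)
    then show "x \<in> ks.span S" by (simp add: fvec_expand)
  qed
qed

text \<open>If \<open>G \<union> B\<close> is independent, then \<open>G\<close> is independent modulo the span of \<open>B\<close>.\<close>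

lemma (in vector_space) independent_mod_span:
  assumes indep: "independent (G \<union> B)" "G \<inter> B = {}" "finite G"
    and "(\<Sum>g\<in>G. a g *s g) \<in> span B" "g \<in> G"
  shows "a g = 0"
proof (rule ccontr)
  assume "a g \<noteq> 0"
  have "span B \<subseteq> span (G \<union> B - {g})" using assms(2,5) by (intro span_mono) auto
  then have "(\<Sum>g\<in>G. a g *s g) \<in> span (G \<union> B - {g})" using assms(4) by auto
  moreover have "(\<Sum>g'\<in>G - {g}. a g' *s g') \<in> span (G \<union> B - {g})"
    by (intro span_sum span_scale span_base) auto
  ultimately have "(\<Sum>g\<in>G. a g *s g) - (\<Sum>g'\<in>G - {g}. a g' *s g') \<in> span (G \<union> B - {g})"
    by (rule span_diff)
  also have "(\<Sum>g\<in>G. a g *s g) - (\<Sum>g'\<in>G - {g}. a g' *s g') = a g *s g"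
    using assms(3,5) by (simp add: sum.remove)
  finally have "inverse (a g) *s (a g *s g) \<in> span (G \<union> B - {g})" by (rule span_scale)
  then have "g \<in> span (G \<union> B - {g})" using \<open>a g \<noteq> 0\<close> by simp
  with indep(1) assms(5) show False by (auto simp: dependent_def)
qed

text \<open>A submodule of a graded free module that contains the homogeneous components of its elements.\<close>

definition graded_submodule :: "(nat \<Rightarrow> nat) \<Rightarrow> ('a, 'k::comm_ring_1) fvec set \<Rightarrow> bool" where
  "graded_submodule b M \<longleftrightarrow> fv.subspace M \<and> M \<subseteq> free_module b \<and> (\<forall>x\<in>M. \<forall>e. fcomp e x \<in> M)"

text \<open>A graded submodule \<open>M\<close> is the image of a graded free module under a map whose kernel has all
  coefficients in $\mathfrak{m}$.  Here \<open>V e\<close> is the degree \<open>e\<close> part of \<open>M\<close>, and \<open>W e\<close> that of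
  $\mathfrak{m}M$.\<close>

lemma minimal_generators:
  fixes M :: "('a::finite, 'k::field) fvec set"
  assumes M: "graded_submodule b M"
  obtains c \<phi> where "module_hom smult smult \<phi>" "\<phi> ` free_module c = M"
    "\<And>e x. x \<in> free_module c \<Longrightarrow> fhomogeneous e x \<Longrightarrow> fhomogeneous e (\<phi> x)"
    "\<And>x. x \<in> free_module c \<Longrightarrow> \<phi> x = 0 \<Longrightarrow> mvec x"
proof -
  have sub: "fv.subspace M" and free: "M \<subseteq> free_module b" and gr: "\<And>x e. x \<in> M \<Longrightarrow> fcomp e x \<in> M"
    using M by (auto simp: graded_submodule_def)
  define V where "V e = {x \<in> M. fhomogeneous e x}" for e
  define W where "W e = ks.span {smult (Var a) y | a y e'. e = Suc e' \<and> y \<in> V e'}" for e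
  have V_sub: "ks.subspace (V e)" for e
    using ks.subspace_inter[OF subspace_imp_ksubspace[OF sub] ksubspace_fhomogeneous[of e]]
    by (simp add: V_def Int_def)
  have W_sub_V: "W e \<subseteq> V e" for e
    unfolding W_def
  proof (rule ks.span_minimal[OF _ V_sub], safe)
    fix a y e' assume "y \<in> V e'"
    then show "smult (Var a) y \<in> V (Suc e')"
      using fhomogeneous_smult[OF homogeneous_Var, of e' y a] fv.subspace_scale[OF sub]
      by (simp add: V_def)
  qed
  have W_mult: "smult q y \<in> W (Suc j + d)" if q: "homogeneous (Suc j) q" and y: "y \<in> V d" for q y j d
  proof -
    have "smult (single m c) y \<in> W (Suc j + d)" if m: "monom_degree m = Suc j" for m c
    proof -
      have "m \<noteq> 0" using m by auto
      then obtain a m' where m': "m = single a 1 + m'" by (rule monom_split_Var)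
      then have "monom_degree m' = j" using m by (simp add: monom_degree_add)
      then have "smult (single m' c) y \<in> V (j + d)"
        using y fhomogeneous_smult[OF homogeneous_single, of d y m' c] fv.subspace_scale[OF sub]
        by (simp add: V_def)
      then have "smult (Var a) (smult (single m' c) y) \<in> W (Suc (j + d))"
        unfolding W_def by (intro ks.span_base) blast
      then show ?thesis by (simp add: m' single_mult_Var del: One_nat_def)
    qed
    then have "(\<Sum>m\<in>keys q. smult (single m (lookup q m)) y) \<in> W (Suc j + d)"
      using q by (auto simp: W_def homogeneous_def intro!: ks.span_sum)
    then show ?thesis by (simp add: poly_mapping_expand flip: fv.scale_sum_left)
  qed
  \<comment> \<open>In each degree, choose a basis of a complement of the part that comes from lower degrees.\<close>
  have "\<exists>G B. finite G \<and> G \<subseteq> V e \<and> G \<inter> B = {} \<and> ks.independent (G \<union> B) \<and> W e = ks.span B \<and>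
      V e \<subseteq> ks.span (G \<union> B)" for e
  proof -
    obtain B where B: "B \<subseteq> W e" "ks.independent B" "W e \<subseteq> ks.span B"
      by (rule ks.maximal_independent_subset)
    have "B \<subseteq> V e" using B(1) W_sub_V by auto
    then obtain B' where B': "B \<subseteq> B'" "B' \<subseteq> V e" "ks.independent B'" "V e \<subseteq> ks.span B'"
      by (rule ks.maximal_independent_subset_extend[OF _ B(2)])
    obtain S :: "('a, 'k) fvec set" where "finite S" "{x \<in> free_module b. fhomogeneous e x} \<subseteq> ks.span S"
      by (rule homogeneous_part_finite_dim)
    then have "finite B'"
      using ks.independent_span_bound[of S B'] B'(2,3) free by (auto simp: V_def)
    moreover have "W e = ks.span B"
      using B(3) ks.span_minimal[OF B(1)] by (auto simp: W_def)
    ultimately show ?thesis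
      using B' by (intro exI[of _ "B' - B"] exI[of _ B]) (auto simp: Un_absorb2)
  qed
  then obtain G B where G: "\<And>e. finite (G e)" "\<And>e. G e \<subseteq> V e" "\<And>e. G e \<inter> B e = {}"
    "\<And>e. ks.independent (G e \<union> B e)" "\<And>e. W e = ks.span (B e)" "\<And>e. V e \<subseteq> ks.span (G e \<union> B e)"
    by metis
  define c where "c e = card (G e)" for e
  have "\<exists>h. bij_betw h {..<c e} (G e)" for e
    using ex_bij_betw_nat_finite[OF G(1)[of e]] by (simp add: c_def lessThan_atLeast0)
  then obtain en where en: "\<And>e. bij_betw (en e) {..<c e} (G e)" by metis
  have en_V: "en d k \<in> V d" if "k < c d" for d k
    using en[of d] G(2)[of d] that by (auto simp: bij_betw_def)
  define \<phi> where "\<phi> = lin (\<lambda>(d, k). en d k)"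
  have hom: "module_hom smult smult \<phi>" unfolding \<phi>_def by (rule hom_lin)
  interpret p: module_hom smult smult \<phi> by (rule hom)
  have phi_unit: "\<phi> (unit (d, k)) = en d k" for d k by (simp add: \<phi>_def)
  have in_M: "\<phi> ` free_module c \<subseteq> M"
    using en_V by (intro hom_maps_free_module hom sub) (auto simp: basis_def phi_unit V_def)
  have graded: "fhomogeneous e (\<phi> x)" if "x \<in> free_module c" "fhomogeneous e x" for e x
  proof -
    have "fhomogeneous (fst i + 0) (\<phi> (unit i))" if "i \<in> basis c" for i
      using en_V that by (cases i) (auto simp: basis_def phi_unit V_def)
    from graded_hom[OF hom this that] show ?thesis by simp
  qed
  have sub_im: "fv.subspace (\<phi> ` free_module c)"
    by (rule p.subspace_image[OF subspace_free_module])
  have V_im: "V e \<subseteq> \<phi> ` free_module c" for e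
  proof (induction e rule: less_induct)
    case (less e)
    have "W e \<subseteq> \<phi> ` free_module c"
      unfolding W_def
    proof (rule ks.span_minimal[OF _ subspace_imp_ksubspace[OF sub_im]], safe)
      fix a y e' assume "y \<in> V e'" "e = Suc e'"
      then show "smult (Var a) y \<in> \<phi> ` free_module c"
        using less.IH[of e'] fv.subspace_scale[OF sub_im] by auto
    qed
    then have "B e \<subseteq> \<phi> ` free_module c" using G(5) ks.span_superset by blast
    moreover have "G e \<subseteq> \<phi> ` free_module c"
    proof
      fix g assume "g \<in> G e"
      then obtain k where "k < c e" "g = en e k" using en[of e] by (auto simp: bij_betw_def)
      then show "g \<in> \<phi> ` free_module c"
        by (intro image_eqI[of _ _ "unit (e, k)"]) (auto simp: phi_unit basis_def intro!: unit_in_free_module)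
    qed
    ultimately have "ks.span (G e \<union> B e) \<subseteq> \<phi> ` free_module c"
      by (intro ks.span_minimal subspace_imp_ksubspace[OF sub_im]) auto
    with G(6) show ?case by blast
  qed
  have "M \<subseteq> \<phi> ` free_module c"
  proof
    fix x assume "x \<in> M"
    then have "fcomp e x \<in> \<phi> ` free_module c" for e
      using V_im[of e] gr by (auto simp: V_def fhomogeneous_fcomp)
    then have "(\<Sum>e\<in>degrees x. fcomp e x) \<in> \<phi> ` free_module c"
      by (intro fv.subspace_sum sub_im)
    then show "x \<in> \<phi> ` free_module c" by (simp add: sum_fcomp)
  qed
  moreover have "mvec x" if x: "x \<in> free_module c" "\<phi> x = 0" for x
    unfolding mvec_def
  proof
    fix i
    show "lookup (lookup x i) 0 = 0"
    proof (cases "i \<in> basis c")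
      case False
      then show ?thesis using x(1) by (simp add: free_module_iff_lookup)
    next
      case True
      obtain e k where i: "i = (e, k)" by (cases i)
      with True have k: "k < c e" by (simp add: basis_def)
      \<comment> \<open>In the degree \<open>e\<close> component of the relation \<open>\<phi> x = 0\<close>, the terms with generators of lower degree lie
        in \<open>W e\<close>, and the generators of degree \<open>e\<close> are independent modulo \<open>W e\<close>.\<close>
      define y where "y = fcomp e x"
      have y: "y \<in> free_module c" "fhomogeneous e y"
        using x by (simp_all add: y_def fcomp_in_free_module fhomogeneous_fcomp)
      have "fcomp (e + 0) (\<phi> x) = \<phi> y"
        unfolding y_def using graded by (intro fcomp_hom[OF hom _ x(1)]) auto
      then have "0 = \<phi> y" using x by simp
      also have "\<dots> = (\<Sum>j\<in>keys y. smult (lookup y j) (\<phi> (unit j)))" by (rule hom_expand[OF hom])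
      also have "\<dots> = (\<Sum>j\<in>{j \<in> keys y. fst j = e}. smult (lookup y j) (\<phi> (unit j))) +
          (\<Sum>j\<in>{j \<in> keys y. fst j \<noteq> e}. smult (lookup y j) (\<phi> (unit j)))"
        by (subst sum.union_disjoint[symmetric]) (auto intro!: sum.cong)
      finally have eq: "(\<Sum>j\<in>{j \<in> keys y. fst j = e}. smult (lookup y j) (\<phi> (unit j))) =
          - (\<Sum>j\<in>{j \<in> keys y. fst j \<noteq> e}. smult (lookup y j) (\<phi> (unit j)))"
        by (simp add: eq_neg_iff_add_eq_0)
      define a where "a g = lookup (lookup y (e, the_inv_into {..<c e} (en e) g)) 0" for g
      have a_en: "a (en e l) = lookup (lookup y (e, l)) 0" if "l < c e" for l
        using en[of e] that by (simp add: a_def bij_betw_def the_inv_into_f_f)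
      have y_hom: "fst j \<le> e \<and> homogeneous (e - fst j) (lookup y j)" if "j \<in> keys y" for j
        using y(2) that by (auto simp: fhomogeneous_iff_homogeneous in_keys_iff)
      have "smult (lookup y j) (\<phi> (unit j)) \<in> W e" if j: "j \<in> keys y" "fst j \<noteq> e" for j
      proof -
        obtain d l where dl: "j = (d, l)" by (cases j)
        then have "d < e" using y_hom[OF j(1)] j(2) by simp
        then have "homogeneous (Suc (e - d - 1)) (lookup y j)"
          using y_hom[OF j(1)] dl by (simp add: Suc_diff_Suc)
        moreover have "en d l \<in> V d"
          using y(1) j(1) by (intro en_V) (auto simp: dl free_module_iff basis_def)
        ultimately have "smult (lookup y j) (en d l) \<in> W (Suc (e - d - 1) + d)" by (rule W_mult)
        then show ?thesis using \<open>d < e\<close> by (simp add: dl phi_unit)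
      qed
      then have "(\<Sum>j\<in>{j \<in> keys y. fst j = e}. smult (lookup y j) (\<phi> (unit j))) \<in> W e"
        unfolding eq W_def by (intro ks.span_neg ks.span_sum) auto
      also have "(\<Sum>j\<in>{j \<in> keys y. fst j = e}. smult (lookup y j) (\<phi> (unit j))) =
          (\<Sum>j\<in>Pair e ` {..<c e}. smult (lookup y j) (\<phi> (unit j)))"
        using y(1) by (intro sum.mono_neutral_left) (auto simp: free_module_iff basis_def in_keys_iff)
      also have "\<dots> = (\<Sum>l<c e. smult (lookup y (e, l)) (en e l))"
        by (simp add: sum.reindex inj_on_def phi_unit)
      also have "\<dots> = (\<Sum>l<c e. kscale (lookup (lookup y (e, l)) 0) (en e l))"
      proof (rule sum.cong)
        fix l
        have "lookup y (e, l) = single 0 (lookup (lookup y (e, l)) 0)"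
        proof (rule poly_mapping_eqI)
          fix m
          show "lookup (lookup y (e, l)) m = lookup (single 0 (lookup (lookup y (e, l)) 0)) m"
          proof (cases "m = 0")
            case False
            then have "monom_degree m + fst (e, l) \<noteq> e" by (simp add: monom_degree_eq_0_iff)
            then have "lookup (lookup y (e, l)) m = 0" using y(2) unfolding fhomogeneous_iff by blast
            with False show ?thesis by (simp add: lookup_single)
          qed simp
        qed
        then show "smult (lookup y (e, l)) (en e l) = kscale (lookup (lookup y (e, l)) 0) (en e l)"
          unfolding kscale_def by simp
      qed simp
      also have "\<dots> = (\<Sum>l<c e. kscale (a (en e l)) (en e l))"
        by (rule sum.cong) (simp_all add: a_en)
      also have "\<dots> = (\<Sum>g\<in>G e. kscale (a g) g)"
        by (rule sum.reindex_bij_betw[OF en])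
      finally have "(\<Sum>g\<in>G e. kscale (a g) g) \<in> ks.span (B e)" by (simp add: G(5))
      moreover have "en e k \<in> G e" using en[of e] k by (auto simp: bij_betw_def)
      ultimately have "a (en e k) = 0" by (rule ks.independent_mod_span[OF G(4,3,1)])
      then have "lookup (lookup y i) 0 = 0" by (simp add: a_en k i)
      then show ?thesis by (simp add: y_def lookup_fcomp i)
    qed
  qed
  ultimately show ?thesis using that[OF hom _ graded] in_M by auto
qed

lemma graded_submodule_kernel:
  assumes hom: "module_hom smult smult \<phi>"
    and gr: "\<And>e x. x \<in> free_module c \<Longrightarrow> fhomogeneous e x \<Longrightarrow> fhomogeneous e (\<phi> x)"
  shows "graded_submodule c {x \<in> free_module c. \<phi> x = 0}"
proof -
  interpret p: module_hom smult smult \<phi> by fact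
  have "\<phi> (fcomp e x) = 0" if "x \<in> free_module c" "\<phi> x = 0" for e x
    using fcomp_hom[OF hom _ that(1), of 0 e] gr that(2) by simp
  then show ?thesis
    using fv.subspace_inter[OF subspace_free_module p.subspace_kernel]
    by (auto simp: graded_submodule_def fcomp_in_free_module Int_def)
qed

text \<open>The resolution starts with $F_0 = R$, which is minimal since \<open>I\<close> is a proper ideal: its elements
  have no constant term.  Each kernel is then covered by minimal generators.\<close>

theorem minimal_resolution_exists:
  fixes I :: "('a::finite, 'k::field) mpoly set"
  assumes I: "graded_ideal I" "\<And>p. p \<in> I \<Longrightarrow> lookup p 0 = 0"
  shows "\<exists>b \<phi> \<epsilon>. minimal_graded_free_resolution I b \<phi> \<epsilon>"
proof -
  define b0 :: "nat \<Rightarrow> nat" where "b0 d = (if d = 0 then 1 else 0)" for d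
  define \<epsilon> :: "('a, 'k) fvec \<Rightarrow> ('a, 'k) mpoly" where "\<epsilon> x = lookup x (0, 0)" for x
  define M0 where "M0 = {x \<in> free_module b0. \<epsilon> x \<in> I}"
  have sub_I: "pr.subspace I" using I(1) by (simp add: graded_ideal_def)
  have b0: "basis b0 = {(0, 0)}" by (auto simp: basis_def b0_def split: if_splits)
  have hom_\<epsilon>: "module_hom smult (*) \<epsilon>"
    by unfold_locales (simp_all add: \<epsilon>_def lookup_add lookup_smult)
  interpret e: module_hom smult "(*)" \<epsilon> by (rule hom_\<epsilon>)
  have eps_hcomp: "\<epsilon> (fcomp e x) = hcomp e (\<epsilon> x)" for e x
    by (rule poly_mapping_eqI) (simp add: \<epsilon>_def lookup_fcomp lookup_hcomp)
  have gr0: "graded_submodule b0 M0"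
    using fv.subspace_inter[OF subspace_free_module e.subspace_linear_preimage[OF sub_I], of b0] I(1)
    by (auto simp: graded_submodule_def M0_def Int_def fcomp_in_free_module eps_hcomp graded_ideal_def)
  have mvec0: "mvec x" if x: "x \<in> M0" for x
    unfolding mvec_def
  proof
    fix i
    show "lookup (lookup x i) 0 = 0"
      using x I(2) b0 by (cases "i = (0, 0)") (auto simp: M0_def \<epsilon>_def free_module_iff_lookup)
  qed
  define P where "P r s \<longleftrightarrow> (case s of (b, M) \<Rightarrow> graded_submodule b M \<and> (\<forall>x\<in>M. mvec x) \<and>
      (r = 0 \<longrightarrow> b = b0 \<and> M = M0))" for r :: nat and s :: "(nat \<Rightarrow> nat) \<times> ('a, 'k) fvec set"
  \<comment> \<open>\<open>D\<close> says that \<open>\<phi>\<close> maps the free module \<open>c\<close> onto \<open>M\<close> with kernel \<open>N\<close>; a state of the recursion is a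
    free module together with the submodule that has to be covered next.\<close>
  define D where "D M c N \<phi> \<longleftrightarrow> module_hom smult smult \<phi> \<and> \<phi> ` free_module c = M \<and>
      (\<forall>e. \<forall>x\<in>free_module c. fhomogeneous e x \<longrightarrow> fhomogeneous e (\<phi> x)) \<and>
      N = {x \<in> free_module c. \<phi> x = 0}"
    for c :: "nat \<Rightarrow> nat" and M N and \<phi> :: "('a, 'k) fvec \<Rightarrow> ('a, 'k) fvec"
  have "\<exists>s. \<forall>r. P r (s r) \<and> (\<exists>\<phi>. D (snd (s r)) (fst (s (Suc r))) (snd (s (Suc r))) \<phi>)"
  proof (rule dependent_nat_choice)
    show "\<exists>s. P 0 s" using gr0 mvec0 by (intro exI[of _ "(b0, M0)"]) (simp add: P_def)
  next
    fix s r assume s: "P r s"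
    obtain b M where bM: "s = (b, M)" by (cases s)
    then have "graded_submodule b M" using s by (simp add: P_def)
    then obtain c \<phi> where c: "module_hom smult smult \<phi>" "\<phi> ` free_module c = M"
      "\<And>e x. x \<in> free_module c \<Longrightarrow> fhomogeneous e x \<Longrightarrow> fhomogeneous e (\<phi> x)"
      "\<And>x. x \<in> free_module c \<Longrightarrow> \<phi> x = 0 \<Longrightarrow> mvec x"
      by (rule minimal_generators) (rule that)
    define N where "N = {x \<in> free_module c. \<phi> x = 0}"
    have "P (Suc r) (c, N)" using graded_submodule_kernel[OF c(1,3)] c(4) by (simp add: P_def N_def)
    moreover have "D M c N \<phi>" using c by (simp add: D_def N_def)
    ultimately show "\<exists>s'. P (Suc r) s' \<and> (\<exists>\<phi>. D (snd s) (fst s') (snd s') \<phi>)"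
      unfolding bM by (intro exI[of _ "(c, N)"]) auto
  qed
  then obtain s where s: "\<And>r. P r (s r)"
    "\<And>r. \<exists>\<phi>. D (snd (s r)) (fst (s (Suc r))) (snd (s (Suc r))) \<phi>"
    by blast
  define b where "b r = fst (s r)" for r
  define M where "M r = snd (s r)" for r
  from s(2) have "\<forall>r. \<exists>\<phi>. D (M r) (b (Suc r)) (M (Suc r)) \<phi>" by (simp add: b_def M_def)
  then obtain \<phi> where D: "\<And>r. D (M r) (b (Suc r)) (M (Suc r)) (\<phi> r)" by metis
  have gr: "graded_submodule (b r) (M r)" and mv: "\<And>x. x \<in> M r \<Longrightarrow> mvec x" for r
    using s(1)[of r] by (auto simp: P_def b_def M_def split: prod.splits)
  have b_0: "b 0 = b0" and M_0: "M 0 = M0"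
    using s(1)[of 0] by (auto simp: P_def b_def M_def split: prod.splits)
  have im: "\<phi> r ` free_module (b (Suc r)) = M r" for r using D[of r] by (simp add: D_def)
  have ker: "{x \<in> free_module (b (Suc r)). \<phi> r x = 0} = M (Suc r)" for r
    using D[of r] by (simp add: D_def)
  have "graded_free_resolution I b \<phi> \<epsilon>"
    unfolding graded_free_resolution_def
  proof (intro conjI allI ballI impI)
    show "module_hom smult (*) \<epsilon>" by (rule hom_\<epsilon>)
    show "homogeneous e (\<epsilon> x)" if "fhomogeneous e x" for e x
      using that by (force simp: fhomogeneous_iff homogeneous_iff \<epsilon>_def)
    show "module_hom smult smult (\<phi> r)" for r using D[of r] by (simp add: D_def)
    show "\<phi> r ` free_module (b (Suc r)) \<subseteq> free_module (b r)" for r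
      using im gr[of r] by (simp add: graded_submodule_def)
    show "fhomogeneous e (\<phi> r x)" if "x \<in> free_module (b (Suc r))" "fhomogeneous e x" for r e x
      using D[of r] that by (simp add: D_def)
    show "\<exists>x\<in>free_module (b 0). p - \<epsilon> x \<in> I" for p
      using pr.subspace_0[OF sub_I]
      by (intro bexI[of _ "smult p (unit (0, 0))"])
        (auto simp: \<epsilon>_def lookup_smult b_0 free_module_iff_lookup b0 lookup_single when_def)
    show "{x \<in> free_module (b 0). \<epsilon> x \<in> I} = \<phi> 0 ` free_module (b 1)"
      using im[of 0] by (simp add: b_0 M_0 M0_def)
    show "{x \<in> free_module (b (Suc r)). \<phi> r x = 0} = \<phi> (Suc r) ` free_module (b (Suc (Suc r)))" for r
      by (simp add: ker im)
  qed
  moreover have "lookup (\<phi> r x) i \<in> irrelevant_ideal" if "x \<in> free_module (b (Suc r))" for r x i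
  proof -
    have "\<phi> r x \<in> M r" using im[of r] that by blast
    then show ?thesis using mv by (simp add: irrelevant_ideal_iff mvec_def)
  qed
  ultimately show ?thesis unfolding minimal_graded_free_resolution_def by blast
qed

lemma minimal_iff_mvec:
  "minimal_graded_free_resolution I b \<phi> \<epsilon> \<longleftrightarrow> graded_free_resolution I b \<phi> \<epsilon> \<and>
    (\<forall>r. \<forall>x\<in>free_module (b (Suc r)). mvec (\<phi> r x))"
  by (simp add: minimal_graded_free_resolution_def mvec_def irrelevant_ideal_iff)

text \<open>By uniqueness, any minimal resolution computes the Betti numbers.\<close>

theorem betti_eq:
  fixes I :: "('a::finite, 'k::field) mpoly set"
  assumes I: "graded_ideal I" and res: "minimal_graded_free_resolution I b \<phi> \<epsilon>"
  shows "betti I r d = (if r < 0 \<or> d < 0 then 0 else b (nat r) (nat d))"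
proof -
  have "b' r d = b r d" if res': "minimal_graded_free_resolution I b' \<phi>' \<epsilon>'" for b' \<phi>' \<epsilon>' r d
  proof (rule antisym)
    have R: "resolution I b \<phi> \<epsilon>" "resolution I b' \<phi>' \<epsilon>'"
      using I res res' by (simp_all add: resolution_def minimal_iff_mvec)
    show "b' r d \<le> b r d" using res' by (intro betti_le[OF R(2,1)]) (simp add: minimal_iff_mvec)
    show "b r d \<le> b' r d" using res by (intro betti_le[OF R]) (simp add: minimal_iff_mvec)
  qed
  then have "(THE n. \<exists>b \<phi> \<epsilon>. minimal_graded_free_resolution I b \<phi> \<epsilon> \<and> n = b (nat r) (nat d)) =
      b (nat r) (nat d)"
    using res by (intro the_equality) blast+
  then show ?thesis by (simp add: betti_def)
qed

section \<open>The mapping cone\<close>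

text \<open>The graded free module $F \oplus F'(-t)$.  In degree \<open>d\<close>, the basis elements of $F'(-t)$ are
  numbered after those of \<open>F\<close>, so that \<open>F\<close> is a submodule; \<open>inr_sum\<close> is the inclusion of
  $F'(-t)$, and \<open>pr1_sum\<close> and \<open>pr2_sum\<close> are the projections.\<close>

definition shift_sum :: "(nat \<Rightarrow> nat) \<Rightarrow> (nat \<Rightarrow> nat) \<Rightarrow> nat \<Rightarrow> nat \<Rightarrow> nat" where
  "shift_sum b b' t d = b d + (if t \<le> d then b' (d - t) else 0)"

definition inr_sum :: "(nat \<Rightarrow> nat) \<Rightarrow> nat \<Rightarrow> ('a, 'k::comm_ring_1) fvec \<Rightarrow> ('a, 'k) fvec" where
  "inr_sum b t = lin (\<lambda>(d, k). unit (d + t, b (d + t) + k))"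

definition pr1_sum :: "(nat \<Rightarrow> nat) \<Rightarrow> ('a, 'k::comm_ring_1) fvec \<Rightarrow> ('a, 'k) fvec" where
  "pr1_sum b = lin (\<lambda>i. if i \<in> basis b then unit i else 0)"

definition pr2_sum :: "(nat \<Rightarrow> nat) \<Rightarrow> nat \<Rightarrow> ('a, 'k::comm_ring_1) fvec \<Rightarrow> ('a, 'k) fvec" where
  "pr2_sum b t = lin (\<lambda>(d, k). if t \<le> d \<and> b d \<le> k then unit (d - t, k - b d) else 0)"

lemma hom_inr_sum: "module_hom smult smult (inr_sum b t)"
  and hom_pr1_sum: "module_hom smult smult (pr1_sum b)"
  and hom_pr2_sum: "module_hom smult smult (pr2_sum b t)"
  by (simp_all add: inr_sum_def pr1_sum_def pr2_sum_def hom_lin)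

lemma inr_sum_unit: "inr_sum b t (unit (d, k)) = unit (d + t, b (d + t) + k)"
  by (simp add: inr_sum_def)

lemma pr1_sum_unit: "pr1_sum b (unit i) = (if i \<in> basis b then unit i else 0)"
  by (simp add: pr1_sum_def)

lemma pr2_sum_unit:
  "pr2_sum b t (unit (d, k)) = (if t \<le> d \<and> b d \<le> k then unit (d - t, k - b d) else 0)"
  by (simp add: pr2_sum_def)

lemma basis_shift_sum_cases:
  assumes "i \<in> basis (shift_sum b b' t)"
  obtains "i \<in> basis b" | d k where "(d, k) \<in> basis b'" "i = (d + t, b (d + t) + k)"
proof -
  obtain e l where i: "i = (e, l)" by (cases i)
  show ?thesis
  proof (cases "l < b e")
    case True
    then show ?thesis using that(1) by (simp add: i basis_def)
  next
    case False
    with assms have "t \<le> e" "l - b e < b' (e - t)" by (auto simp: i basis_def shift_sum_def split: if_splits)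
    with False show ?thesis using that(2)[of "e - t" "l - b e"] by (auto simp: i basis_def)
  qed
qed

lemma free_module_subset_shift_sum: "x \<in> free_module b \<Longrightarrow> x \<in> free_module (shift_sum b b' t)"
  by (force simp: free_module_iff basis_def shift_sum_def)

lemma inr_sum_in:
  assumes "y \<in> free_module b'"
  shows "inr_sum b t y \<in> free_module (shift_sum b b' t)"
proof -
  have "inr_sum b t (unit i) \<in> free_module (shift_sum b b' t)" if "i \<in> basis b'" for i
    using that by (cases i) (simp add: inr_sum_unit basis_def shift_sum_def unit_in_free_module)
  from hom_maps_free_module[OF hom_inr_sum this subspace_free_module] assms show ?thesis by blast
qed

lemma hom_ident: "module_hom smult smult (\<lambda>x. x :: ('a, 'k::comm_ring_1) fvec)"
  by unfold_locales simp_all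

lemma hom_zero: "module_hom smult smult (\<lambda>x. 0 :: ('a, 'k::comm_ring_1) fvec)"
  by unfold_locales simp_all

lemma pr1_sum_free: "x \<in> free_module b \<Longrightarrow> pr1_sum b x = x"
  using hom_eq_on_free_module[OF hom_pr1_sum hom_ident, of b b x]
  by (simp add: pr1_sum_unit)

lemma pr2_sum_free: "x \<in> free_module b \<Longrightarrow> pr2_sum b t x = 0"
  by (rule hom_eq_on_free_module[OF hom_pr2_sum hom_zero, of b]) (auto simp: pr2_sum_unit basis_def)

lemma hom_eq_all:
  assumes "module_hom smult s f" "module_hom smult s g" "\<And>d k. f (unit (d, k)) = g (unit (d, k))"
  shows "f x = g x"
  by (subst hom_expand[OF assms(1)], subst hom_expand[OF assms(2)]) (auto simp: assms(3) intro!: sum.cong)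

lemma pr1_sum_inr: "pr1_sum b (inr_sum b t y) = 0"
  using hom_eq_all[OF module_hom_compose[OF hom_inr_sum hom_pr1_sum] hom_zero, where x = y]
  by (simp add: pr1_sum_unit inr_sum_unit basis_def)

lemma pr2_sum_inr: "pr2_sum b t (inr_sum b t y) = y"
  using hom_eq_all[OF module_hom_compose[OF hom_inr_sum hom_pr2_sum] hom_ident, where x = y]
  by (simp add: pr2_sum_unit inr_sum_unit)

lemma pr1_sum_in: "pr1_sum b z \<in> free_module b"
proof -
  have "pr1_sum b (unit i) \<in> free_module b" for i :: "nat \<times> nat"
    using fv.subspace_0[OF subspace_free_module] by (auto simp: pr1_sum_unit unit_in_free_module)
  then show ?thesis
    unfolding hom_expand[OF hom_pr1_sum, of b z]
    by (intro fv.subspace_sum fv.subspace_scale subspace_free_module) auto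
qed

lemma pr2_sum_in: "z \<in> free_module (shift_sum b b' t) \<Longrightarrow> pr2_sum b t z \<in> free_module b'"
proof -
  have "pr2_sum b t (unit i) \<in> free_module b'" if "i \<in> basis (shift_sum b b' t)" for i
    using that
  proof (rule basis_shift_sum_cases)
    assume "i \<in> basis b"
    then show ?thesis
      by (simp add: pr2_sum_free unit_in_free_module fv.subspace_0[OF subspace_free_module])
  next
    fix d k assume "(d, k) \<in> basis b'" "i = (d + t, b (d + t) + k)"
    then show ?thesis by (simp add: pr2_sum_unit unit_in_free_module)
  qed
  from hom_maps_free_module[OF hom_pr2_sum this subspace_free_module]
  show "z \<in> free_module (shift_sum b b' t) \<Longrightarrow> pr2_sum b t z \<in> free_module b'" by auto
qed

lemma shift_sum_decomp:
  assumes "z \<in> free_module (shift_sum b b' t)"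
  shows "pr1_sum b z + inr_sum b t (pr2_sum b t z) = z"
proof -
  interpret p: module_hom smult smult "pr1_sum b" by (rule hom_pr1_sum)
  interpret q: module_hom smult smult "pr2_sum b t" by (rule hom_pr2_sum)
  interpret i: module_hom smult smult "inr_sum b t" by (rule hom_inr_sum)
  have hom: "module_hom smult smult (\<lambda>z. pr1_sum b z + inr_sum b t (pr2_sum b t z))"
    by unfold_locales (simp_all add: p.add p.scale q.add q.scale i.add i.scale fv.scale_right_distrib)
  show ?thesis
  proof (rule hom_eq_on_free_module[OF hom hom_ident _ assms])
    fix j :: "nat \<times> nat" assume "j \<in> basis (shift_sum b b' t)"
    then show "pr1_sum b (unit j) + inr_sum b t (pr2_sum b t (unit j)) = unit j"
    proof (rule basis_shift_sum_cases)
      assume "j \<in> basis b"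
      then show ?thesis by (simp add: pr1_sum_free pr2_sum_free unit_in_free_module)
    next
      fix d k assume "j = (d + t, b (d + t) + k)"
      then show ?thesis by (simp add: pr1_sum_unit pr2_sum_unit inr_sum_unit basis_def)
    qed
  qed
qed

lemma mvec_add: "mvec x \<Longrightarrow> mvec y \<Longrightarrow> mvec (x + y)"
  by (simp add: mvec_def lookup_add)

lemma mvec_diff: "mvec x \<Longrightarrow> mvec y \<Longrightarrow> mvec (x - y)"
  by (simp add: mvec_def lookup_minus)

text \<open>If \<open>I'\<close> is the colon ideal $I : xf$ for a variable \<open>x\<close>, and \<open>\<psi>\<close> lifts
  multiplication by \<open>f\<close> to the minimal resolutions of $R/I'$ and $R/I$, then \<open>x\<psi>\<close> lifts
  the injection of a shift of $R/I'$ into $R/I$ with cokernel $R/(I + (xf))$.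
  Its mapping cone resolves this cokernel, and is minimal because of the factor \<open>x\<close>.\<close>

theorem mapping_cone:
  fixes I :: "('a::finite, 'k::comm_ring_1) mpoly set"
  assumes R: "resolution I b \<phi> \<epsilon>" and R': "resolution I' b' \<phi>' \<epsilon>'"
    and min: "\<And>r x. x \<in> free_module (b (Suc r)) \<Longrightarrow> mvec (\<phi> r x)"
    and min': "\<And>r x. x \<in> free_module (b' (Suc r)) \<Longrightarrow> mvec (\<phi>' r x)"
    and f: "homogeneous s f" "\<And>p. p \<in> I' \<Longrightarrow> f * p \<in> I"
    and colon: "\<And>p. Var a * f * p \<in> I \<Longrightarrow> p \<in> I'"
    and J: "\<And>q. q \<in> J \<longleftrightarrow> (\<exists>p. q - Var a * f * p \<in> I)"
  shows "\<exists>\<delta>. graded_free_resolution J (case_nat (b 0) (\<lambda>r. shift_sum (b (Suc r)) (b' r) (Suc s))) \<delta> \<epsilon> \<and>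
    (\<forall>r. \<forall>x\<in>free_module (shift_sum (b (Suc r)) (b' r) (Suc s)). mvec (\<delta> r x))"
proof -
  interpret R: resolution I b \<phi> \<epsilon> by fact
  interpret R': resolution I' b' \<phi>' \<epsilon>' by fact
  obtain \<psi> where psi_hom: "\<And>r. module_hom smult smult (\<psi> r)"
    and psi_in: "\<And>r x. x \<in> free_module (b' r) \<Longrightarrow> \<psi> r x \<in> free_module (b r)"
    and psi_graded: "\<And>r e x. x \<in> free_module (b' r) \<Longrightarrow> fhomogeneous e x \<Longrightarrow> fhomogeneous (e + s) (\<psi> r x)"
    and psi_aug: "\<And>x. x \<in> free_module (b' 0) \<Longrightarrow> \<epsilon> (\<psi> 0 x) - f * \<epsilon>' x \<in> I"
    and psi_chain: "\<And>r x. x \<in> free_module (b' (Suc r)) \<Longrightarrow> \<phi> r (\<psi> (Suc r) x) = \<psi> r (\<phi>' r x)"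
    by (rule comparison[OF R' R f]) (assumption | rule that)+
  define c where "c = case_nat (b 0) (\<lambda>r. shift_sum (b (Suc r)) (b' r) (Suc s))"
  have c0: "c 0 = b 0" and cS: "c (Suc r) = shift_sum (b (Suc r)) (b' r) (Suc s)" for r
    by (simp_all add: c_def)
  define inr where "inr r = (inr_sum (b (Suc r)) (Suc s) :: ('a, 'k) fvec \<Rightarrow> _)" for r
  define pr1 where "pr1 r = (pr1_sum (b (Suc r)) :: ('a, 'k) fvec \<Rightarrow> _)" for r
  define pr2 where "pr2 r = (pr2_sum (b (Suc r)) (Suc s) :: ('a, 'k) fvec \<Rightarrow> _)" for r
  \<comment> \<open>The differential of the cone from $F_{r+1} \oplus F'_r(-s-1)$ to $F_r \oplus F'_{r-1}(-s-1)$; its second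
    component \<open>- \<rho>\<close> is absent for \<open>r = 0\<close>, where the target is $F_0$.\<close>
  define \<rho> where "\<rho> r y = (case r of 0 \<Rightarrow> 0 | Suc q \<Rightarrow> inr q (\<phi>' q y))" for r y
  define \<delta> where "\<delta> r z = \<phi> r (pr1 r z) + smult (Var a) (\<psi> r (pr2 r z)) - \<rho> r (pr2 r z)" for r z
  have inr_hom: "module_hom smult smult (inr r)" and pr1_hom: "module_hom smult smult (pr1 r)"
    and pr2_hom: "module_hom smult smult (pr2 r)" for r
    by (simp_all add: inr_def pr1_def pr2_def hom_inr_sum hom_pr1_sum hom_pr2_sum)
  have pr1_in: "pr1 r z \<in> free_module (b (Suc r))" for r z
    by (simp add: pr1_def pr1_sum_in)
  have pr2_in: "pr2 r z \<in> free_module (b' r)" if "z \<in> free_module (c (Suc r))" for r z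
    using that by (simp add: pr2_def cS pr2_sum_in)
  have decomp: "pr1 r z + inr r (pr2 r z) = z" if "z \<in> free_module (c (Suc r))" for r z
    using that by (simp add: pr1_def pr2_def inr_def cS shift_sum_decomp)
  have inr_in: "inr r y \<in> free_module (c (Suc r))" if "y \<in> free_module (b' r)" for r y
    using that by (simp add: inr_def cS inr_sum_in)
  have inl_in: "x \<in> free_module (c (Suc r))" if "x \<in> free_module (b (Suc r))" for r x
    using that by (simp add: cS free_module_subset_shift_sum)
  have pr1_sum: "pr1 r (x + inr r y) = x" and pr2_sum: "pr2 r (x + inr r y) = y"
    if "x \<in> free_module (b (Suc r))" for r x y
    using that
    by (simp_all add: pr1_def pr2_def inr_def module_hom.add[OF hom_pr1_sum] module_hom.add[OF hom_pr2_sum]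
        pr1_sum_free pr2_sum_free pr1_sum_inr pr2_sum_inr)
  have rho_hom: "module_hom smult smult (\<rho> r)" for r
  proof (cases r)
    case 0
    then show ?thesis by unfold_locales (simp_all add: \<rho>_def)
  next
    case (Suc q)
    then have "\<rho> r = inr q \<circ> \<phi>' q" by (simp add: \<rho>_def fun_eq_iff)
    then show ?thesis using module_hom_compose[OF R'.hom_diff inr_hom] by simp
  qed
  have rho_in: "\<rho> r y \<in> free_module (c r)" if "y \<in> free_module (b' r)" for r y
    using that fv.subspace_0[OF subspace_free_module]
    by (cases r) (auto simp: \<rho>_def intro!: inr_in R'.diff_in)
  have delta_hom: "module_hom smult smult (\<delta> r)" for r
  proof -
    interpret p: module_hom smult smult "pr1 r" by (rule pr1_hom)
    interpret q: module_hom smult smult "pr2 r" by (rule pr2_hom)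
    interpret phi: module_hom smult smult "\<phi> r" by (rule R.hom_diff)
    interpret psi: module_hom smult smult "\<psi> r" by (rule psi_hom)
    interpret rho: module_hom smult smult "\<rho> r" by (rule rho_hom)
    show ?thesis
      by unfold_locales
        (simp_all add: \<delta>_def p.add p.scale q.add q.scale phi.add phi.scale psi.add psi.scale
          rho.add rho.scale fv.scale_right_distrib fv.scale_right_diff_distrib mult.commute)
  qed
  have delta_sum: "\<delta> r (x + inr r y) = \<phi> r x + smult (Var a) (\<psi> r y) - \<rho> r y"
    if "x \<in> free_module (b (Suc r))" for r x y
    by (simp add: \<delta>_def pr1_sum[OF that] pr2_sum[OF that])
  have in_c: "x \<in> free_module (c r)" if "x \<in> free_module (b r)" for r x
    using that inl_in by (cases r) (auto simp: c0)
  have delta_in: "\<delta> r z \<in> free_module (c r)" if "z \<in> free_module (c (Suc r))" for r z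
    unfolding \<delta>_def
    by (intro fv.subspace_diff fv.subspace_add fv.subspace_scale subspace_free_module in_c rho_in
        R.diff_in pr1_in psi_in pr2_in that)
  have delta_mvec: "mvec (\<delta> r z)" if "z \<in> free_module (c (Suc r))" for r z
  proof -
    have "mvec (smult (Var a) y)" for y :: "('a, 'k) fvec"
      by (simp add: mvec_def lookup_smult lookup_mult_0 Var_def lookup_single when_def
          single_1_neq_0[unfolded One_nat_def])
    moreover have "mvec (\<rho> r (pr2 r z))"
    proof (cases r)
      case (Suc q)
      then show ?thesis using min'[of "pr2 r z" q] pr2_in[OF that] by (simp add: \<rho>_def mvec_hom[OF inr_hom])
    qed (simp add: \<rho>_def mvec_def)
    ultimately show ?thesis
      unfolding \<delta>_def by (intro mvec_add mvec_diff min pr1_in)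
  qed
  have delta_graded: "fhomogeneous e (\<delta> r z)" if z: "z \<in> free_module (c (Suc r))" "fhomogeneous e z" for r e z
  proof -
    have "fhomogeneous (fst i + 0) (\<delta> r (unit i))" if "i \<in> basis (c (Suc r))" for i
      using that unfolding cS
    proof (rule basis_shift_sum_cases)
      assume i: "i \<in> basis (b (Suc r))"
      interpret psi: module_hom smult smult "\<psi> r" by (rule psi_hom)
      interpret rho: module_hom smult smult "\<rho> r" by (rule rho_hom)
      interpret in': module_hom smult smult "inr r" by (rule inr_hom)
      have "\<delta> r (unit i) = \<phi> r (unit i)"
        using delta_sum[OF unit_in_free_module[OF i], of 0] by simp
      then show ?thesis using R.diff_graded[OF unit_in_free_module[OF i] fhomogeneous_unit] by simp
    next
      fix d k assume dk: "(d, k) \<in> basis (b' r)" and i: "i = (d + Suc s, b (Suc r) (d + Suc s) + k)"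
      interpret phi: module_hom smult smult "\<phi> r" by (rule R.hom_diff)
      let ?u = "unit (d, k) :: ('a, 'k) fvec"
      have u: "?u \<in> free_module (b' r)" "fhomogeneous d ?u"
        using dk fhomogeneous_unit[of "(d, k)"] by (auto intro: unit_in_free_module)
      have "unit i = inr r ?u" by (simp add: i inr_def inr_sum_unit)
      then have "\<delta> r (unit i) = smult (Var a) (\<psi> r ?u) - \<rho> r ?u"
        using delta_sum[OF fv.subspace_0[OF subspace_free_module], of r ?u] by simp
      moreover have "fhomogeneous (d + Suc s) (smult (Var a) (\<psi> r ?u))"
        using fhomogeneous_smult[OF homogeneous_Var psi_graded[OF u]] by simp
      moreover have "fhomogeneous (d + Suc s) (\<rho> r ?u)"
      proof (cases r)
        case (Suc q)
        have g: "fhomogeneous (fst j + Suc s) (inr q (unit j))" if "j \<in> basis (b' q)" for j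
          using fhomogeneous_unit[of "(fst j + Suc s, b (Suc q) (fst j + Suc s) + snd j)"]
          by (cases j) (simp add: inr_def inr_sum_unit)
        have "\<phi>' q ?u \<in> free_module (b' q)" "fhomogeneous d (\<phi>' q ?u)"
          using u R'.diff_in R'.diff_graded by (simp_all add: Suc)
        from graded_hom[OF inr_hom g this] show ?thesis by (simp add: \<rho>_def Suc)
      qed (simp add: \<rho>_def)
      ultimately show ?thesis by (simp add: i fhomogeneous_diff)
    qed
    from graded_hom[OF delta_hom this z] show ?thesis by simp
  qed
  interpret e: module_hom smult "(*)" \<epsilon> by (rule R.hom_aug)
  have I_add: "p \<in> I \<Longrightarrow> q \<in> I \<Longrightarrow> p + q \<in> I" and I_diff: "p \<in> I \<Longrightarrow> q \<in> I \<Longrightarrow> p - q \<in> I"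
    and I_scale: "q \<in> I \<Longrightarrow> p * q \<in> I" for p q
    by (simp_all add: pr.subspace_add[OF R.subspace_I] pr.subspace_diff[OF R.subspace_I]
        pr.subspace_scale[OF R.subspace_I])
  have x_psi: "\<epsilon> (smult (Var a) (\<psi> 0 y)) - Var a * f * \<epsilon>' y \<in> I" if "y \<in> free_module (b' 0)" for y
    using I_scale[OF psi_aug[OF that], of "Var a"] by (simp only: e.scale right_diff_distrib mult.assoc)
  have exact0: "{x \<in> free_module (c 0). \<epsilon> x \<in> J} = \<delta> 0 ` free_module (c 1)"
  proof safe
    fix z :: "('a, 'k) fvec" assume z: "z \<in> free_module (c 1)"
    then have z': "z \<in> free_module (c (Suc 0))" by simp
    show "\<delta> 0 z \<in> free_module (c 0)" by (rule delta_in[OF z'])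
    have "\<epsilon> (\<delta> 0 z) - Var a * f * \<epsilon>' (pr2 0 z) =
        \<epsilon> (\<phi> 0 (pr1 0 z)) + (\<epsilon> (smult (Var a) (\<psi> 0 (pr2 0 z))) - Var a * f * \<epsilon>' (pr2 0 z))"
      by (simp add: \<delta>_def \<rho>_def e.add)
    also have "\<dots> \<in> I" by (intro I_add R.aug_diff pr1_in x_psi pr2_in z')
    finally show "\<epsilon> (\<delta> 0 z) \<in> J" unfolding J by blast
  next
    fix x :: "('a, 'k) fvec" assume x: "x \<in> free_module (c 0)" "\<epsilon> x \<in> J"
    then obtain p where p: "\<epsilon> x - Var a * f * p \<in> I" unfolding J by blast
    obtain y where y: "y \<in> free_module (b' 0)" "p - \<epsilon>' y \<in> I'" using R'.aug_onto by blast
    have "Var a * (f * (p - \<epsilon>' y)) \<in> I" by (rule I_scale[OF f(2)[OF y(2)]])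
    then have "(\<epsilon> x - Var a * f * p) + Var a * (f * (p - \<epsilon>' y)) -
        (\<epsilon> (smult (Var a) (\<psi> 0 y)) - Var a * f * \<epsilon>' y) \<in> I"
      by (intro I_diff I_add p x_psi y)
    also have "(\<epsilon> x - Var a * f * p) + Var a * (f * (p - \<epsilon>' y)) -
        (\<epsilon> (smult (Var a) (\<psi> 0 y)) - Var a * f * \<epsilon>' y) = \<epsilon> (x - smult (Var a) (\<psi> 0 y))"
      by (simp only: e.diff right_diff_distrib mult.assoc) simp
    finally have "\<epsilon> (x - smult (Var a) (\<psi> 0 y)) \<in> I" .
    moreover have "x - smult (Var a) (\<psi> 0 y) \<in> free_module (b 0)"
      using x(1) unfolding c0 by (intro fv.subspace_diff fv.subspace_scale subspace_free_module psi_in y)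
    ultimately have "x - smult (Var a) (\<psi> 0 y) \<in> \<phi> 0 ` free_module (b 1)"
      using R.exact_aug by blast
    then obtain x' where x': "x' \<in> free_module (b (Suc 0))" "x - smult (Var a) (\<psi> 0 y) = \<phi> 0 x'" by auto
    have "x = \<delta> 0 (x' + inr 0 y)"
      using x'(2) by (simp add: delta_sum[OF x'(1)] \<rho>_def algebra_simps)
    moreover have "x' + inr 0 y \<in> free_module (c 1)"
      using fv.subspace_add[OF subspace_free_module inl_in[OF x'(1)] inr_in[OF y(1)]] by simp
    ultimately show "x \<in> \<delta> 0 ` free_module (c 1)" by blast
  qed
  have exact: "{z \<in> free_module (c (Suc r)). \<delta> r z = 0} = \<delta> (Suc r) ` free_module (c (Suc (Suc r)))" for r
  proof -
    interpret phi: module_hom smult smult "\<phi> r" by (rule R.hom_diff)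
    interpret phi': module_hom smult smult "\<phi>' r" by (rule R'.hom_diff)
    interpret psi: module_hom smult smult "\<psi> r" by (rule psi_hom)
    interpret psi1: module_hom smult smult "\<psi> (Suc r)" by (rule psi_hom)
    interpret rho: module_hom smult smult "\<rho> r" by (rule rho_hom)
    interpret in': module_hom smult smult "inr r" by (rule inr_hom)
    interpret in1: module_hom smult smult "inr (Suc r)" by (rule inr_hom)
    have rho_Suc: "\<rho> (Suc r) y = inr r (\<phi>' r y)" for y by (simp add: \<rho>_def)
    show ?thesis
    proof safe
      fix z :: "('a, 'k) fvec" assume z: "z \<in> free_module (c (Suc (Suc r)))"
      show "\<delta> (Suc r) z \<in> free_module (c (Suc r))" by (rule delta_in[OF z])
      let ?x = "pr1 (Suc r) z" and ?y = "pr2 (Suc r) z"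
      let ?w = "\<phi> (Suc r) ?x + smult (Var a) (\<psi> (Suc r) ?y)"
      have w: "?w \<in> free_module (b (Suc r))"
        by (intro fv.subspace_add fv.subspace_scale subspace_free_module R.diff_in pr1_in psi_in pr2_in z)
      have "\<delta> r (\<delta> (Suc r) z) = \<delta> r (?w + inr r (- \<phi>' r ?y))"
        by (simp add: \<delta>_def[of "Suc r"] rho_Suc in'.neg)
      also have "\<dots> = \<phi> r ?w - smult (Var a) (\<psi> r (\<phi>' r ?y)) + \<rho> r (\<phi>' r ?y)"
        by (simp add: delta_sum[OF w] psi.neg rho.neg)
      also have "\<phi> r ?w = smult (Var a) (\<psi> r (\<phi>' r ?y))"
        by (simp add: phi.add phi.scale R.diff_diff[OF pr1_in] psi_chain[OF pr2_in[OF z]])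
      also have "\<rho> r (\<phi>' r ?y) = 0"
      proof (cases r)
        case (Suc q)
        then show ?thesis using R'.diff_diff[of ?y q] pr2_in[OF z] module_hom.zero[OF inr_hom, of q]
          by (simp add: \<rho>_def)
      qed (simp add: \<rho>_def)
      finally show "\<delta> r (\<delta> (Suc r) z) = 0" by simp
    next
      fix z :: "('a, 'k) fvec" assume z: "z \<in> free_module (c (Suc r))" and 0: "\<delta> r z = 0"
      define x where "x = pr1 r z"
      define y where "y = pr2 r z"
      have x: "x \<in> free_module (b (Suc r))" and y: "y \<in> free_module (b' r)"
        by (simp_all add: x_def y_def pr1_in pr2_in z)
      have eq: "\<phi> r x + smult (Var a) (\<psi> r y) - \<rho> r y = 0" using 0 by (simp add: \<delta>_def x_def y_def)
      have "y \<in> \<phi>' r ` free_module (b' (Suc r)) \<and> \<rho> r y = 0"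
      proof (cases r)
        case 0
        have y0: "y \<in> free_module (b' 0)" and x0: "x \<in> free_module (b (Suc 0))" using x y by (simp_all add: 0)
        have "\<epsilon> (smult (Var a) (\<psi> 0 y)) = - \<epsilon> (\<phi> 0 x)"
          using eq by (simp add: 0 \<rho>_def add_eq_0_iff flip: e.neg)
        then have "\<epsilon> (smult (Var a) (\<psi> 0 y)) \<in> I"
          using pr.subspace_neg[OF R.subspace_I R.aug_diff[OF x0]] by simp
        from I_diff[OF this x_psi[OF y0]] have "Var a * f * \<epsilon>' y \<in> I" by simp
        then have "\<epsilon>' y \<in> I'" by (rule colon)
        then show ?thesis using R'.exact_aug[OF y0] by (simp add: 0 \<rho>_def)
      next
        case (Suc q)
        have y': "y \<in> free_module (b' (Suc q))" using y Suc by simp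
        let ?w = "\<phi> r x + smult (Var a) (\<psi> r y)"
        have w: "?w \<in> free_module (b (Suc q))"
          unfolding Suc[symmetric] by (intro fv.subspace_add fv.subspace_scale subspace_free_module R.diff_in psi_in x y)
        have "?w + inr q (- \<phi>' q y) = 0"
          using eq by (simp add: Suc \<rho>_def module_hom.neg[OF inr_hom])
        then have "\<phi>' q y = 0"
          using pr2_sum[OF w, of "- \<phi>' q y"] module_hom.zero[OF pr2_hom, of q] by simp
        then show ?thesis
          using R'.exact[OF y'] by (simp add: Suc \<rho>_def module_hom.zero[OF inr_hom])
      qed
      then obtain y' where y': "y' \<in> free_module (b' (Suc r))" "y = \<phi>' r y'" and "\<rho> r y = 0" by blast
      have "\<phi> r (x + smult (Var a) (\<psi> (Suc r) y')) = 0"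
        using eq \<open>\<rho> r y = 0\<close> by (simp add: phi.add phi.scale psi_chain[OF y'(1)] y'(2))
      moreover have "x + smult (Var a) (\<psi> (Suc r) y') \<in> free_module (b (Suc r))"
        by (intro fv.subspace_add fv.subspace_scale subspace_free_module psi_in x y')
      ultimately have "x + smult (Var a) (\<psi> (Suc r) y') \<in> \<phi> (Suc r) ` free_module (b (Suc (Suc r)))"
        using R.exact by blast
      then obtain x' where x': "x' \<in> free_module (b (Suc (Suc r)))"
        "x + smult (Var a) (\<psi> (Suc r) y') = \<phi> (Suc r) x'" by auto
      have "\<delta> (Suc r) (x' + inr (Suc r) (- y')) = \<phi> (Suc r) x' - smult (Var a) (\<psi> (Suc r) y') + inr r y"
        by (simp add: delta_sum[OF x'(1)] rho_Suc psi1.neg phi'.neg in'.neg y'(2))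
      also have "\<dots> = x + inr r y" by (simp flip: x'(2))
      also have "\<dots> = z" unfolding x_def y_def by (rule decomp[OF z])
      finally have "z = \<delta> (Suc r) (x' + inr (Suc r) (- y'))" by simp
      moreover have "x' + inr (Suc r) (- y') \<in> free_module (c (Suc (Suc r)))"
        by (intro fv.subspace_add subspace_free_module inl_in x' inr_in fv.subspace_neg y')
      ultimately show "z \<in> \<delta> (Suc r) ` free_module (c (Suc (Suc r)))" by blast
    qed
  qed
  have "graded_free_resolution J c \<delta> \<epsilon>"
    unfolding graded_free_resolution_def
  proof (intro conjI allI ballI impI)
    show "\<exists>x\<in>free_module (c 0). p - \<epsilon> x \<in> J" for p
    proof -
      obtain x where x: "x \<in> free_module (b 0)" "p - \<epsilon> x \<in> I" using R.aug_onto by blast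
      moreover have "p - \<epsilon> x - Var a * f * 0 \<in> I" using x(2) by simp
      ultimately show ?thesis unfolding c0 J by blast
    qed
    show "\<delta> r ` free_module (c (Suc r)) \<subseteq> free_module (c r)" for r using delta_in by blast
    show "homogeneous e (\<epsilon> x)" if "x \<in> free_module (c 0)" "fhomogeneous e x" for e x
      using R.aug_graded that by (simp add: c0)
  qed (fact R.hom_aug delta_hom exact0 exact | rule delta_graded; assumption)+
  with delta_mvec show ?thesis unfolding c_def by (intro exI[of _ \<delta>]) simp
qed

section \<open>Monomial ideals\<close>

text \<open>Divisibility of a monomial by one of the monomials with exponent vectors in \<open>A\<close>.\<close>

definition divisible :: "('a \<Rightarrow>\<^sub>0 nat) set \<Rightarrow> ('a \<Rightarrow>\<^sub>0 nat) \<Rightarrow> bool" where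
  "divisible A m \<longleftrightarrow> (\<exists>a\<in>A. \<exists>c. m = a + c)"

text \<open>The ideal generated by the monomials with exponent vectors in \<open>A\<close>, described as the set of polynomials
  all of whose monomials are divisible by a generator.\<close>

definition mon_ideal :: "('a \<Rightarrow>\<^sub>0 nat) set \<Rightarrow> ('a, 'k::comm_ring_1) mpoly set" where
  "mon_ideal A = {p. \<forall>m\<in>keys p. divisible A m}"

lemma divisible_add: "divisible A m \<Longrightarrow> divisible A (m + m')"
  unfolding divisible_def by (metis add.assoc)

lemma divisible_mono: "divisible A m \<Longrightarrow> (\<And>a. a \<in> A \<Longrightarrow> divisible B a) \<Longrightarrow> divisible B m"
  using divisible_add by (fastforce simp: divisible_def[of A])

lemma divisible_base: "a \<in> A \<Longrightarrow> divisible A a"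
  unfolding divisible_def by (metis add_0_right)

lemma mon_ideal_eqI:
  "(\<And>a. a \<in> A \<Longrightarrow> divisible B a) \<Longrightarrow> (\<And>b. b \<in> B \<Longrightarrow> divisible A b) \<Longrightarrow> mon_ideal A = mon_ideal B"
  using divisible_mono[of A _ B] divisible_mono[of B _ A] by (auto simp: mon_ideal_def)

lemma subspace_mon_ideal: "pr.subspace (mon_ideal A)"
proof (rule pr.subspaceI)
  show "0 \<in> mon_ideal A" by (simp add: mon_ideal_def)
next
  fix p q :: "('a, 'k::comm_ring_1) mpoly" assume "p \<in> mon_ideal A" "q \<in> mon_ideal A"
  then show "p + q \<in> mon_ideal A" using keys_add[of p q] by (auto simp: mon_ideal_def)
next
  fix p q :: "('a, 'k::comm_ring_1) mpoly" assume q: "q \<in> mon_ideal A"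
  show "p * q \<in> mon_ideal A"
    unfolding mon_ideal_def
  proof (intro CollectI ballI)
    fix m assume "m \<in> keys (p * q)"
    then obtain m1 m2 where "m = m1 + m2" "m2 \<in> keys q" using keys_mult[of p q] by blast
    then show "divisible A m" using q divisible_add[of A m2 m1] by (simp add: mon_ideal_def add.commute)
  qed
qed

lemma ideal_gen_monomials:
  "ideal_gen ((\<lambda>a. single a 1) ` A) = (mon_ideal A :: ('a, 'k::comm_ring_1) mpoly set)"
  unfolding ideal_gen_def
proof
  show "pr.span ((\<lambda>a. single a (1 :: 'k)) ` A) \<subseteq> mon_ideal A"
    by (rule pr.span_minimal[OF _ subspace_mon_ideal]) (auto simp: mon_ideal_def divisible_base)
  show "mon_ideal A \<subseteq> pr.span ((\<lambda>a. single a (1 :: 'k)) ` A)"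
  proof
    fix p :: "('a, 'k) mpoly" assume p: "p \<in> mon_ideal A"
    have "single m (lookup p m) \<in> pr.span ((\<lambda>a. single a (1 :: 'k)) ` A)" if "m \<in> keys p" for m
    proof -
      obtain a c where ac: "a \<in> A" "m = a + c" using p \<open>m \<in> keys p\<close> by (auto simp: mon_ideal_def divisible_def)
      have "single m (lookup p m) = single c (lookup p m) * single a 1"
        by (simp add: ac mult_single add.commute)
      also have "\<dots> \<in> pr.span ((\<lambda>a. single a (1 :: 'k)) ` A)"
        by (intro pr.span_scale pr.span_base imageI ac)
      finally show ?thesis .
    qed
    then have "(\<Sum>m\<in>keys p. single m (lookup p m)) \<in> pr.span ((\<lambda>a. single a (1 :: 'k)) ` A)"
      by (rule pr.span_sum)
    then show "p \<in> pr.span ((\<lambda>a. single a (1 :: 'k)) ` A)" by (simp add: poly_mapping_expand)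
  qed
qed

lemma mon_ideal_insert_iff: "q \<in> mon_ideal (insert a A) \<longleftrightarrow> (\<exists>p. q - single a 1 * p \<in> mon_ideal A)"
  by (simp add: ideal_gen_def pr.span_insert mult.commute flip: ideal_gen_monomials)

lemma lookup_monomial_mult: "lookup (single a 1 * p) (a + m) = lookup (p :: ('a, 'k::comm_ring_1) mpoly) m"
proof -
  have "single a 1 * p = (\<Sum>k\<in>keys p. single (a + k) (lookup p k))"
    by (subst poly_mapping_expand[symmetric]) (simp add: sum_distrib_left mult_single)
  then have "lookup (single a 1 * p) (a + m) = (\<Sum>k\<in>keys p. if k = m then lookup p k else 0)"
    by (simp add: lookup_sum lookup_single when_def)
  also have "\<dots> = lookup p m" by (simp add: in_keys_iff)
  finally show ?thesis .
qed

lemma monomial_mult_in_mon_ideal_iff: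
  "single a 1 * p \<in> mon_ideal A \<longleftrightarrow> (\<forall>m\<in>keys p. divisible A (a + m))"
  for p :: "('a, 'k::comm_ring_1) mpoly"
proof
  assume "single a 1 * p \<in> mon_ideal A"
  moreover have "a + m \<in> keys (single a 1 * p)" if "m \<in> keys p" for m
    using that by (simp add: in_keys_iff lookup_monomial_mult)
  ultimately show "\<forall>m\<in>keys p. divisible A (a + m)" by (simp add: mon_ideal_def)
next
  assume R: "\<forall>m\<in>keys p. divisible A (a + m)"
  have "keys (single a 1 * p) \<subseteq> (+) a ` keys p"
    using keys_mult[of "single a 1" p] by auto
  with R show "single a 1 * p \<in> mon_ideal A" by (auto simp: mon_ideal_def)
qed

lemma graded_mon_ideal: "graded_ideal (mon_ideal A :: ('a, 'k::comm_ring_1) mpoly set)"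
  unfolding graded_ideal_def
proof (intro conjI ballI allI)
  show "pr.subspace (mon_ideal A :: ('a, 'k) mpoly set)" by (rule subspace_mon_ideal)
  fix p :: "('a, 'k) mpoly" and e
  assume p: "p \<in> mon_ideal A"
  have "keys (hcomp e p) \<subseteq> keys p" by (auto simp: in_keys_iff lookup_hcomp)
  with p show "hcomp e p \<in> mon_ideal A" by (auto simp: mon_ideal_def)
qed

lemma zero_eq_add_iff: "0 = a + c \<longleftrightarrow> a = 0 \<and> c = (0 :: 'a \<Rightarrow>\<^sub>0 nat)"
  by (metis add_eq_0_iff_both_eq_0 lookup_add lookup_zero poly_mapping_eqI add_0)

lemma minimal_resolution_mon_ideal:
  assumes "0 \<notin> A"
  shows "\<exists>b \<phi> \<epsilon>. minimal_graded_free_resolution (mon_ideal A :: ('a::finite, 'k::field) mpoly set) b \<phi> \<epsilon>"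
proof (rule minimal_resolution_exists[OF graded_mon_ideal])
  fix p :: "('a, 'k) mpoly" assume p: "p \<in> mon_ideal A"
  have "\<not> divisible A 0" using assms by (auto simp: divisible_def zero_eq_add_iff)
  then have "0 \<notin> keys p" using p by (auto simp: mon_ideal_def)
  then show "lookup p 0 = 0" by (simp add: in_keys_iff)
qed

text \<open>The effect on Betti numbers of adjoining the generator $x u$ to a monomial ideal, for a variable
  \<open>x\<close> and a monomial \<open>u\<close>.  The hypotheses say that \<open>A'\<close> generates the colon ideal by $x u$, and that
  already \<open>u\<close> multiplies it into the ideal generated by \<open>A\<close>.\<close>

theorem betti_mon_ideal_insert:
  fixes A A' :: "('a::finite \<Rightarrow>\<^sub>0 nat) set"
  assumes A: "0 \<notin> A" "0 \<notin> A'"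
    and colon: "\<And>m. divisible A (single x 1 + u + m) \<Longrightarrow> divisible A' m"
    and mult: "\<And>m. divisible A' m \<Longrightarrow> divisible A (u + m)"
  shows "betti (mon_ideal (insert (single x 1 + u) A) :: ('a, 'k::field) mpoly set) r d =
    betti (mon_ideal A :: ('a, 'k) mpoly set) r d +
    betti (mon_ideal A' :: ('a, 'k) mpoly set) (r - 1) (d - 1 - int (monom_degree u))"
proof -
  let ?I = "mon_ideal A :: ('a, 'k) mpoly set" and ?I' = "mon_ideal A' :: ('a, 'k) mpoly set"
  let ?J = "mon_ideal (insert (single x 1 + u) A) :: ('a, 'k) mpoly set"
  let ?s = "monom_degree u"
  obtain b \<phi> \<epsilon> where res: "minimal_graded_free_resolution ?I b \<phi> \<epsilon>"
    using minimal_resolution_mon_ideal[OF A(1)] by blast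
  obtain b' \<phi>' \<epsilon>' where res': "minimal_graded_free_resolution ?I' b' \<phi>' \<epsilon>'"
    using minimal_resolution_mon_ideal[OF A(2)] by blast
  have R: "resolution ?I b \<phi> \<epsilon>" "resolution ?I' b' \<phi>' \<epsilon>'"
    using res res' by (simp_all add: resolution_def graded_mon_ideal minimal_iff_mvec)
  have monom: "Var x * single u 1 = (single (single x 1 + u) 1 :: ('a, 'k) mpoly)"
    by (simp add: Var_def mult_single)
  let ?c = "case_nat (b 0) (\<lambda>r. shift_sum (b (Suc r)) (b' r) (Suc ?s))"
  have "\<exists>\<delta>. graded_free_resolution ?J ?c \<delta> \<epsilon> \<and>
    (\<forall>r. \<forall>x\<in>free_module (shift_sum (b (Suc r)) (b' r) (Suc ?s)). mvec (\<delta> r x))"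
  proof (rule mapping_cone[OF R])
    show "mvec (\<phi> r x)" if "x \<in> free_module (b (Suc r))" for r x
      using res that by (simp add: minimal_iff_mvec)
    show "mvec (\<phi>' r x)" if "x \<in> free_module (b' (Suc r))" for r x
      using res' that by (simp add: minimal_iff_mvec)
    show "homogeneous ?s (single u 1 :: ('a, 'k) mpoly)" by (rule homogeneous_single)
    show "single u 1 * p \<in> ?I" if "p \<in> ?I'" for p
      using that mult unfolding monomial_mult_in_mon_ideal_iff by (simp add: mon_ideal_def)
    show "p \<in> ?I'" if "Var x * single u 1 * p \<in> ?I" for p
      using that colon unfolding monom monomial_mult_in_mon_ideal_iff by (simp add: mon_ideal_def)
    show "q \<in> ?J \<longleftrightarrow> (\<exists>p. q - Var x * single u 1 * p \<in> ?I)" for q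
      unfolding monom by (rule mon_ideal_insert_iff)
  qed
  then obtain \<delta> where "minimal_graded_free_resolution ?J ?c \<delta> \<epsilon>"
    by (auto simp: minimal_iff_mvec)
  note eqs = betti_eq[OF graded_mon_ideal this] betti_eq[OF graded_mon_ideal res]
    betti_eq[OF graded_mon_ideal res']
  show ?thesis
  proof (cases "r < 0 \<or> d < 0")
    case True
    then show ?thesis unfolding eqs by auto
  next
    case False
    show ?thesis
    proof (cases "nat r")
      case 0
      then show ?thesis using False unfolding eqs by auto
    next
      case (Suc q)
      then have "nat (r - 1) = q" "\<not> r - 1 < 0" by auto
      moreover have "nat (d - 1 - int ?s) = nat d - Suc ?s" by auto
      moreover have "Suc ?s \<le> nat d \<longleftrightarrow> \<not> d - 1 - int ?s < 0" by auto
      ultimately show ?thesis using False Suc unfolding eqs by (simp add: shift_sum_def)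
    qed
  qed
qed

section \<open>Adjoining a star\<close>

lemma divisible_cancel:
  assumes "divisible {a} (single x n + m)" "lookup a x = 0"
  shows "divisible {a} m"
proof -
  obtain c where c: "single x n + m = a + c" using assms(1) by (auto simp: divisible_def)
  have "m = a + (c - single x n)"
  proof (rule poly_mapping_eqI)
    fix y
    have "lookup (single x n) y + lookup m y = lookup a y + lookup c y"
      using c by (metis lookup_add)
    then show "lookup m y = lookup (a + (c - single x n)) y"
      using assms(2) by (auto simp: lookup_add lookup_minus lookup_single when_def split: if_splits)
  qed
  then show ?thesis by (auto simp: divisible_def)
qed

lemma divisible_iff_single: "divisible A m \<longleftrightarrow> (\<exists>a\<in>A. divisible {a} m)"
  by (simp add: divisible_def)

lemma divisible_add_left_iff: "divisible {b + a} (b + m) \<longleftrightarrow> divisible {a} m"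
  unfolding divisible_def by (auto simp: add.assoc)

text \<open>Pascal's rule, summed.\<close>

lemma sum_choose_Suc:
  fixes f :: "nat \<Rightarrow> nat"
  shows "(\<Sum>i\<le>Suc n. (Suc n choose i) * f i) =
    (\<Sum>i\<le>n. (n choose i) * f i) + (\<Sum>i\<le>n. (n choose i) * f (Suc i))"
proof -
  have "(\<Sum>i\<le>Suc n. (Suc n choose i) * f i) = f 0 + (\<Sum>i\<le>n. (Suc n choose Suc i) * f (Suc i))"
    by (subst sum.atMost_Suc_shift) simp
  also have "\<dots> = f 0 + (\<Sum>i\<le>n. (n choose Suc i) * f (Suc i)) + (\<Sum>i\<le>n. (n choose i) * f (Suc i))"
    by (simp add: sum.distrib add_mult_distrib)
  also have "f 0 + (\<Sum>i\<le>n. (n choose Suc i) * f (Suc i)) = (\<Sum>i\<le>Suc n. (n choose i) * f i)"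
    by (subst sum.atMost_Suc_shift) simp
  also have "\<dots> = (\<Sum>i\<le>n. (n choose i) * f i)" by simp
  finally show ?thesis .
qed

text \<open>A variable that does not occur in \<open>A\<close> is a nonzerodivisor modulo the ideal generated by \<open>A\<close>.  The
  Betti numbers are those of the tensor product of the resolution with a Koszul complex on $k$
  variables.\<close>

lemma betti_adjoin_variables:
  fixes A :: "('a::finite \<Rightarrow>\<^sub>0 nat) set"
  assumes A: "0 \<notin> A" "\<And>a i. a \<in> A \<Longrightarrow> i \<in> {1..n} \<Longrightarrow> lookup a (xs i) = 0"
    and inj: "inj_on xs {1..n}" and k: "k \<le> n"
  shows "betti (mon_ideal (A \<union> (\<lambda>i. single (xs i) 1) ` {1..k}) :: ('a, 'k::field) mpoly set) r d =
    (\<Sum>i\<le>k. (k choose i) * betti (mon_ideal A :: ('a, 'k) mpoly set) (r - int i) (d - int i))"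
  using k
proof (induction k arbitrary: r d)
  case 0
  then show ?case by simp
next
  case (Suc k)
  let ?B = "A \<union> (\<lambda>i. single (xs i) 1) ` {1..k}"
  have k: "Suc k \<in> {1..n}" "k \<le> n" using Suc.prems by auto
  have B: "lookup a (xs (Suc k)) = 0" if "a \<in> ?B" for a
    using that A(2)[OF _ k(1)] inj_onD[OF inj _ _ k(1)] k
    by (fastforce simp: lookup_single when_def)
  have "0 \<noteq> single z (1::nat)" for z :: 'a by (rule single_1_neq_0[THEN not_sym])
  then have 0: "0 \<notin> ?B" using A(1) by blast
  have ins: "A \<union> (\<lambda>i. single (xs i) 1) ` {1..Suc k} = insert (single (xs (Suc k)) 1 + 0) ?B"
    by (simp add: atLeastAtMostSuc_conv)
  have "betti (mon_ideal (insert (single (xs (Suc k)) 1 + 0) ?B) :: ('a, 'k) mpoly set) r d =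
    betti (mon_ideal ?B :: ('a, 'k) mpoly set) r d +
    betti (mon_ideal ?B :: ('a, 'k) mpoly set) (r - 1) (d - 1 - int (monom_degree (0 :: 'a \<Rightarrow>\<^sub>0 nat)))"
  proof (rule betti_mon_ideal_insert[OF 0 0])
    show "divisible ?B m" if div: "divisible ?B (single (xs (Suc k)) 1 + 0 + m)" for m
    proof -
      obtain a where a: "a \<in> ?B" "divisible {a} (single (xs (Suc k)) 1 + m)"
        using div by (subst (asm) divisible_iff_single) auto
      then show ?thesis using divisible_cancel[OF a(2) B] by (subst divisible_iff_single) blast
    qed
  qed simp
  also have "\<dots> = (\<Sum>i\<le>k. (k choose i) * betti (mon_ideal A :: ('a, 'k) mpoly set) (r - int i) (d - int i)) +
     (\<Sum>i\<le>k. (k choose i) * betti (mon_ideal A :: ('a, 'k) mpoly set) (r - int (Suc i)) (d - int (Suc i)))"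
    unfolding Suc.IH[OF k(2)] by (simp add: algebra_simps)
  finally show ?case unfolding ins sum_choose_Suc .
qed

text \<open>Adjoining the products of a new variable \<open>y\<close> with new variables $x_1,\dots,x_k$.  The colon ideal
  by $x_{k+1} y$ is generated by \<open>A\<close> and $x_1,\dots,x_k$.\<close>

lemma betti_adjoin_star:
  fixes A :: "('a::finite \<Rightarrow>\<^sub>0 nat) set"
  assumes A: "0 \<notin> A" "\<And>a i. a \<in> A \<Longrightarrow> i \<in> {1..n} \<Longrightarrow> lookup a (xs i) = 0"
      "\<And>a. a \<in> A \<Longrightarrow> lookup a y = 0"
    and inj: "inj_on xs {1..n}" and k: "k \<le> n"
  shows "betti (mon_ideal (A \<union> (\<lambda>i. single (xs i) 1 + single y 1) ` {1..k}) :: ('a, 'k::field) mpoly set) r d =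
    betti (mon_ideal A :: ('a, 'k) mpoly set) r d +
    (\<Sum>i = 1..k. (k choose i) * betti (mon_ideal A :: ('a, 'k) mpoly set) (r - int i) (d - int i - 1))"
  using k
proof (induction k)
  case 0
  then show ?case by simp
next
  case (Suc k)
  let ?B = "A \<union> (\<lambda>i. single (xs i) 1 + single y 1) ` {1..k}"
  let ?C = "A \<union> (\<lambda>i. single (xs i) 1) ` {1..k}"
  let ?f = "\<lambda>i. betti (mon_ideal A :: ('a, 'k) mpoly set) (r - int i) (d - int i - 1)"
  have k: "Suc k \<in> {1..n}" "k \<le> n" using Suc.prems by auto
  have xs: "lookup (single (xs i) (1::nat)) (xs (Suc k)) = 0" if "i \<in> {1..k}" for i
    using that inj_onD[OF inj _ _ k(1), of i] k by (auto simp: lookup_single when_def)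
  have "0 \<noteq> single z (1::nat)" for z :: 'a by (rule single_1_neq_0[THEN not_sym])
  moreover have "0 \<noteq> single z (1::nat) + single y 1" for z
    by (simp only: zero_eq_add_iff single_1_neq_0 simp_thms)
  ultimately have 0: "0 \<notin> ?B" "0 \<notin> ?C" using A(1) by blast+
  have ins: "A \<union> (\<lambda>i. single (xs i) 1 + single y 1) ` {1..Suc k} = insert (single (xs (Suc k)) 1 + single y 1) ?B"
    by (simp add: atLeastAtMostSuc_conv)
  have "betti (mon_ideal (insert (single (xs (Suc k)) 1 + single y 1) ?B) :: ('a, 'k) mpoly set) r d =
    betti (mon_ideal ?B :: ('a, 'k) mpoly set) r d +
    betti (mon_ideal ?C :: ('a, 'k) mpoly set) (r - 1) (d - 1 - int (monom_degree (single y 1)))"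
  proof (rule betti_mon_ideal_insert[OF 0])
    fix m
    show "divisible ?C m" if div: "divisible ?B (single (xs (Suc k)) 1 + single y 1 + m)"
    proof -
      obtain a where a: "a \<in> ?B" and div: "divisible {a} (single (xs (Suc k)) 1 + (single y 1 + m))"
        using div by (subst (asm) divisible_iff_single) (auto simp: add.assoc)
      from a have "\<exists>c\<in>?C. divisible {c} m"
      proof
        assume a: "a \<in> A"
        have "divisible {a} m"
          by (rule divisible_cancel[OF divisible_cancel[OF div A(2)[OF a k(1)]] A(3)[OF a]])
        with a show ?thesis by blast
      next
        assume "a \<in> (\<lambda>i. single (xs i) 1 + single y 1) ` {1..k}"
        then obtain i where i: "i \<in> {1..k}" "a = single (xs i) 1 + single y 1" by blast
        have "divisible {single y 1 + single (xs i) 1} (single y 1 + (single (xs (Suc k)) 1 + m))"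
          using div i(2) by (simp only: ac_simps)
        then have "divisible {single (xs i) 1} (single (xs (Suc k)) 1 + m)"
          by (simp only: divisible_add_left_iff)
        from divisible_cancel[OF this xs[OF i(1)]] i(1) show ?thesis by blast
      qed
      then show ?thesis by (rule divisible_iff_single[THEN iffD2])
    qed
    show "divisible ?B (single y 1 + m)" if div: "divisible ?C m"
    proof -
      obtain c where c: "c \<in> ?C" and div: "divisible {c} m"
        using divisible_iff_single[THEN iffD1, OF div] by blast
      from c have "\<exists>a\<in>?B. divisible {a} (single y 1 + m)"
      proof
        assume "c \<in> A"
        moreover have "divisible {c} (single y 1 + m)"
          using divisible_add[OF div, of "single y 1"] by (simp add: add.commute)
        ultimately show ?thesis by blast
      next
        assume "c \<in> (\<lambda>i. single (xs i) 1) ` {1..k}"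
        then obtain i where i: "i \<in> {1..k}" "c = single (xs i) 1" by blast
        have "divisible {single y 1 + single (xs i) 1} (single y 1 + m)"
          using div by (simp only: divisible_add_left_iff i(2))
        then have "divisible {single (xs i) 1 + single y 1} (single y 1 + m)" by (simp only: add.commute)
        with i(1) show ?thesis by blast
      qed
      then show ?thesis by (rule divisible_iff_single[THEN iffD2])
    qed
  qed
  also have "betti (mon_ideal ?C :: ('a, 'k) mpoly set) (r - 1) (d - 1 - int (monom_degree (single y 1))) =
      (\<Sum>i\<le>k. (k choose i) * ?f (Suc i))"
    using betti_adjoin_variables[OF A(1,2) inj k(2), where 'k = 'k, of "r - 1" "d - 2"]
    by (simp add: algebra_simps)
  also have "betti (mon_ideal ?B :: ('a, 'k) mpoly set) r d =
      betti (mon_ideal A :: ('a, 'k) mpoly set) r d + (\<Sum>i = 1..k. (k choose i) * ?f i)"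
    by (rule Suc.IH[OF k(2)])
  finally have eq:
    "betti (mon_ideal (insert (single (xs (Suc k)) 1 + single y 1) ?B) :: ('a, 'k) mpoly set) r d =
    betti (mon_ideal A :: ('a, 'k) mpoly set) r d + ((\<Sum>i = 1..k. (k choose i) * ?f i) +
    (\<Sum>i\<le>k. (k choose i) * ?f (Suc i)))" by simp
  have split: "(\<Sum>i\<le>j. (j choose i) * ?f i) = ?f 0 + (\<Sum>i = 1..j. (j choose i) * ?f i)" for j
    by (simp add: atMost_atLeast0 sum.atLeast_Suc_atMost)
  have "?f 0 + (\<Sum>i = 1..Suc k. (Suc k choose i) * ?f i) =
      ?f 0 + ((\<Sum>i = 1..k. (k choose i) * ?f i) + (\<Sum>i\<le>k. (k choose i) * ?f (Suc i)))"
    using sum_choose_Suc[of k ?f] unfolding split by simp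
  then show ?case unfolding ins eq by simp
qed

section \<open>Closed neighborhood ideals\<close>

text \<open>The exponent vector of the squarefree monomial with support \<open>S\<close>.\<close>

definition expo :: "'a set \<Rightarrow> 'a \<Rightarrow>\<^sub>0 nat" where
  "expo S = (\<Sum>y\<in>S. single y 1)"

lemma lookup_expo: "lookup (expo S) x = (if x \<in> S then 1 else 0)" for S :: "'a::finite set"
proof -
  have "lookup (expo S) x = (\<Sum>y\<in>S. if y = x then 1 else 0)"
    by (simp add: expo_def lookup_sum lookup_single when_def)
  then show ?thesis by simp
qed

lemma prod_Var_eq: "(\<Prod>y\<in>S. Var y) = (single (expo S) 1 :: ('a, 'k::comm_ring_1) mpoly)"
  unfolding expo_def
  by (induction S rule: infinite_finite_induct) (auto simp: Var_def mult_single)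

lemma divisible_expo:
  fixes S S' :: "'a::finite set"
  assumes "S \<in> F" "S \<subseteq> S'"
  shows "divisible (expo ` F) (expo S')"
proof -
  have "expo S' = expo S + expo (S' - S)"
    using assms(2) by (intro poly_mapping_eqI) (auto simp: lookup_add lookup_expo)
  with assms(1) show ?thesis by (auto simp: divisible_def)
qed

lemma NI_eq_mon_ideal: "NI G = mon_ideal (expo ` closed_nbrs G ` pverts G)"
  unfolding NI_def ideal_gen_monomials[symmetric] prod_Var_eq
  by (rule arg_cong[of _ _ ideal_gen]) auto

lemma closed_nbrs_delete_verts:
  "w \<notin> S \<Longrightarrow> closed_nbrs (delete_verts T S) w = closed_nbrs T w - S"
  by (auto simp: closed_nbrs_def nbrs_def delete_verts_def)

theorem theorem5p4:
  fixes T T' :: "'a::finite pair_pre_digraph"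
    and v :: 'a and vs :: "nat \<Rightarrow> 'a" and n :: nat and r d :: int
  assumes tree: "graph_tree T" and verts: "pverts T = UNIV"
    and leaf1: "leaf T (vs 1)" and nbr1: "nbrs T (vs 1) = {v}"
    and n_pos: "n > 0"
    and leaves: "bij_betw vs {1..n} {x \<in> nbrs T v. leaf T x}"
    and at_most_one: "\<forall>u\<in>nbrs T v. \<forall>u'\<in>nbrs T v. \<not> leaf T u \<longrightarrow> \<not> leaf T u' \<longrightarrow> u = u'"
    and u_leaf: "\<forall>u\<in>nbrs T v. \<not> leaf T u \<longrightarrow> (\<exists>w\<in>nbrs T u. leaf T w)"
    and T': "T' = delete_verts T ({v} \<union> vs ` {1..n})"
  shows "betti (NI T :: ('a, 'k::field) mpoly set) r d =
     betti (NI T' :: ('a, 'k) mpoly set) r d +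
     (\<Sum>i = 1..n. (n choose i) * betti (NI T' :: ('a, 'k) mpoly set) (r - int i) (d - int i - 1))"
proof -
  interpret pair_graph T using tree by (simp add: graph_tree_def)
  have sym: "y \<in> nbrs T x \<longleftrightarrow> x \<in> nbrs T y" for x y
    using pair_sym_arcs by (auto simp: nbrs_def symmetric_def elim: symE)
  have irrefl: "x \<notin> nbrs T x" for x
    using pair_no_loops[of "(x, x)"] by (auto simp: nbrs_def)
  define L where "L = vs ` {1..n}"
  have L: "L = {x \<in> nbrs T v. leaf T x}" using leaves by (simp add: L_def bij_betw_def)
  have leaf_nbrs: "nbrs T l = {x}" if "leaf T l" "x \<in> nbrs T l" for l x
    using that by (auto simp: leaf_def card_1_singleton_iff)
  have L_nbrs: "closed_nbrs T l = {l, v}" if "l \<in> L" for l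
    using that leaf_nbrs[of l v] sym by (auto simp: L closed_nbrs_def)
  have vs1: "vs 1 \<in> L" using n_pos by (auto simp: L_def)
  have v_notin: "v \<notin> L" using irrefl by (auto simp: L)
  let ?S = "{v} \<union> L"
  let ?F = "closed_nbrs T ` UNIV" and ?F' = "closed_nbrs T' ` pverts T'"
  let ?E = "(\<lambda>i. {vs i, v}) ` {1..n}"
  have T'_L: "T' = delete_verts T ?S" by (simp only: T' L_def)
  have T'_nbrs: "closed_nbrs T' w = closed_nbrs T w - ?S" if "w \<notin> ?S" for w
    unfolding T'_L by (rule closed_nbrs_delete_verts[OF that])
  have verts': "pverts T' = - ?S"
    by (simp add: T'_L delete_verts_def verts Compl_eq_Diff_UNIV)
  \<comment> \<open>The edge from a non-leaf neighbour \<open>u\<close> of \<open>v\<close> to its leaf makes the generator at \<open>u\<close>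
    redundant, both before and after the deletion of \<open>v\<close>.\<close>
  have u: "\<exists>w'. w' \<notin> ?S \<and> closed_nbrs T w' = closed_nbrs T' w' \<and>
      closed_nbrs T w' \<subseteq> closed_nbrs T' w" if w: "w \<notin> ?S" "w \<in> nbrs T v" for w
  proof -
    have "\<not> leaf T w" using w by (auto simp: L)
    then obtain w' where w': "w' \<in> nbrs T w" "leaf T w'" using u_leaf w(2) by blast
    have nbrs: "nbrs T w' = {w}" using leaf_nbrs[OF w'(2)] w'(1) sym by blast
    have "w' \<noteq> v"
    proof
      assume "w' = v"
      then have "vs 1 = w" using nbrs vs1 by (auto simp: L)
      with w(1) vs1 show False by simp
    qed
    moreover have "w' \<notin> L" using nbrs w(1) sym by (auto simp: L)
    ultimately have w'_S: "w' \<notin> ?S" by simp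
    have c: "closed_nbrs T w' = {w', w}" by (simp add: closed_nbrs_def nbrs)
    have "closed_nbrs T' w' = closed_nbrs T w'"
      unfolding T'_nbrs[OF w'_S] c using w'_S w(1) by blast
    moreover have "closed_nbrs T w' \<subseteq> closed_nbrs T' w"
      unfolding T'_nbrs[OF w(1)] c using w'_S w(1) w'(1) by (auto simp: closed_nbrs_def)
    ultimately show ?thesis using w'_S by metis
  qed
  have not_u: "closed_nbrs T' w = closed_nbrs T w" if "w \<notin> ?S" "w \<notin> nbrs T v" for w
  proof -
    have "x \<notin> ?S" if x: "x \<in> closed_nbrs T w" for x
    proof
      assume S: "x \<in> ?S"
      then have "x \<in> nbrs T w" using x \<open>w \<notin> ?S\<close> by (auto simp: closed_nbrs_def)
      then have "w \<in> nbrs T x" by (simp add: sym)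
      with S show False using L_nbrs[of x] \<open>w \<notin> ?S\<close> \<open>w \<notin> nbrs T v\<close> by (auto simp: closed_nbrs_def)
    qed
    then show ?thesis unfolding T'_nbrs[OF that(1)] by blast
  qed
  have "mon_ideal (expo ` ?F) = (mon_ideal (expo ` (?F' \<union> ?E)) :: ('a, 'k) mpoly set)"
  proof (rule mon_ideal_eqI)
    fix a assume "a \<in> expo ` ?F"
    then obtain w where a: "a = expo (closed_nbrs T w)" by blast
    have "\<exists>S\<in>?F' \<union> ?E. S \<subseteq> closed_nbrs T w"
    proof (cases "w \<in> ?S")
      case True
      have "\<exists>l\<in>L. {l, v} \<subseteq> closed_nbrs T w"
      proof (cases "w = v")
        case True
        then show ?thesis using vs1 by (auto simp: L closed_nbrs_def)
      next
        case False
        then show ?thesis using True L_nbrs by blast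
      qed
      then show ?thesis unfolding L_def by blast
    next
      case False
      then have "closed_nbrs T' w \<in> ?F'" "closed_nbrs T' w \<subseteq> closed_nbrs T w"
        by (auto simp: verts' T'_nbrs)
      then show ?thesis by blast
    qed
    then obtain S where "S \<in> ?F' \<union> ?E" "S \<subseteq> closed_nbrs T w" by blast
    then show "divisible (expo ` (?F' \<union> ?E)) a" unfolding a by (rule divisible_expo)
  next
    fix a assume "a \<in> expo ` (?F' \<union> ?E)"
    then obtain S where a: "a = expo S" "S \<in> ?F' \<union> ?E" by blast
    from a(2) have "\<exists>S'\<in>?F. S' \<subseteq> S"
    proof
      assume "S \<in> ?F'"
      then obtain w where "w \<notin> ?S" "S = closed_nbrs T' w" unfolding verts' by blast
      then show ?thesis using u[of w] not_u[of w] by (cases "w \<in> nbrs T v") auto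
    next
      assume "S \<in> ?E"
      then obtain l where "l \<in> L" "S = {l, v}" by (auto simp: L_def)
      then show ?thesis using L_nbrs by blast
    qed
    then obtain S' where "S' \<in> ?F" "S' \<subseteq> S" by blast
    then show "divisible (expo ` ?F) a" unfolding a by (rule divisible_expo)
  qed
  moreover have "expo ` ?E = (\<lambda>i. single (vs i) 1 + single v 1) ` {1..n}"
  proof -
    have "expo {vs i, v} = single (vs i) 1 + single v 1" if "i \<in> {1..n}" for i
    proof -
      have "vs i \<noteq> v" using v_notin that by (auto simp: L_def)
      then show ?thesis by (simp add: expo_def)
    qed
    then show ?thesis by (auto simp: image_image)
  qed
  ultimately have NI_T: "(NI T :: ('a, 'k) mpoly set) =
      mon_ideal (expo ` ?F' \<union> (\<lambda>i. single (vs i) 1 + single v 1) ` {1..n})"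
    by (simp add: NI_eq_mon_ideal verts image_Un)
  have NI_T': "(NI T' :: ('a, 'k) mpoly set) = mon_ideal (expo ` ?F')"
    by (rule NI_eq_mon_ideal)
  have free: "lookup a x = 0" if "a \<in> expo ` ?F'" "x \<in> ?S" for a x
    using that by (auto simp: verts' T'_nbrs lookup_expo)
  show ?thesis
    unfolding NI_T NI_T'
  proof (rule betti_adjoin_star)
    have "lookup (expo (closed_nbrs T' w)) w = 1" for w
      by (simp add: lookup_expo closed_nbrs_def)
    then show "0 \<notin> expo ` ?F'" by (metis imageE lookup_zero zero_neq_one)
    show "inj_on vs {1..n}" using leaves by (simp add: bij_betw_def)
  qed (use free in \<open>auto simp: L_def\<close>)
qed

end
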